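(* Let $n,m,k\ge1$ be integers, let $\Omega=\{\omega_1,\dots,\omega_k\}$ be a set of basis input functions of the form described in the context, with $\ell_{\max}=\max\{\ell_1,\dots,\ell_k\}$, and let $\mathcal{G}_{1,L}$ be the control system concept class with scalar outputs ($p=1$) and loss function $L(z_1,z_2)=\dfrac{(z_1-z_2)^2}{1+(z_1-z_2)^2}$. Then $$\mathrm{PD}(\mathcal{G}_{1,L})\le 2\left(2mn^2+4n+1\right)\log_2\Big[16e\big(8mn^2k(n+\ell_{\max})+1\big)\big(2nk+2(2k+1)^n\big)\Big].$$
   Context: Basis input functions: $\omega_1,\dots,\omega_k:[0,1]\to\mathbb{R}$ are linearly independent, and for each $j$ either $\omega_j(t)=t^{\ell_j}e^{\alpha_j t}\sin(\beta_j t)$ or $\omega_j(t)=t^{\ell_j}e^{\alpha_j t}\cos(\beta_j t)$ with $\ell_j\in\{0,1,2,\dots\}$ and $\alpha_j,\beta_j\in\mathbb{R}$. Put $\omega=(\omega_1,\dots,\omega_k)^T$. Systems: a linear system $\Sigma=(A,B,C,x^0)$ of dimension $n$ with $m$ inputs and scalar output is $\dot x=Ax+Bu$, $x(0)=x^0$, $y=Cx$ on $[0,1]$, with $A,B,C$ real matrices of sizes $n\times n$, $n\times m$, $1\times n$ and $x^0\in\mathbb{R}^n$. Let $X_\Omega=\{G\omega:[0,1]\to\mathbb{R}^m : G\in\mathbb{R}^{m\times k}\}$, $\Phi_\Sigma:X_\Omega\to\mathbb{R}$, $\Phi_\Sigma(G\omega)=y(1)$ (final output of $\Sigma$ under control $u=G\omega$),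 and $\widetilde{\mathcal{F}}=\{\Phi_\Sigma:\Sigma\text{ a linear system of dimension }n\}$. Pseudo-dimension with respect to a loss function: for a class $\mathcal{F}$ of functions $X\to Y$ and a loss $L:Y\times Y\to[0,r]$, for each $f\in\mathcal{F}$ let $A_{f,L}:X\times Y\times\mathbb{R}\to\{0,1\}$, $(x,y,\rho)\mapsto\mathrm{sign}(L(f(x),y)-\rho)$, where $\mathrm{sign}\,z=1$ if $z>0$ and $0$ if $z\le0$. Let $A_{\mathcal{F},L}=\{A_{f,L}:f\in\mathcal{F}\}$ and $\mathrm{PD}[\mathcal{F},L]:=\mathrm{VC}(A_{\mathcal{F},L})$, where $\mathrm{VC}$ is the largest cardinality of a set $D$ such that every map $D\to\{0,1\}$ is the restriction of a member of the class. The control system concept class is $\mathcal{G}_{1,L}=A_{\widetilde{\mathcal{F}},L}$ (with $Y=\mathbb{R}$), and $\mathrm{PD}(\mathcal{G}_{1,L})$ denotes $\mathrm{PD}[\widetilde{\mathcal{F}},L]=\mathrm{VC}(A_{\widetilde{\mathcal{F}},L})$. *)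

theory Defs
  imports "HOL-Analysis.Analysis"
begin

definition shatters :: "('z \<Rightarrow> nat) set \<Rightarrow> 'z set \<Rightarrow> bool" where
  "shatters H D \<longleftrightarrow> (\<forall>g \<in> D \<rightarrow>\<^sub>E {0, 1}. \<exists>h\<in>H. restrict h D = g)"

text \<open>Functions on a set \<open>Z\<close> are represented by total functions whose values outside \<open>Z\<close>
  are never inspected; hence the explicit domain argument. Subsets of shattered sets are
  shattered, so the supremum over finite sets is \<open>\<infinity>\<close> exactly when no largest
  cardinality exists or an infinite set is shattered.\<close>

definition VC :: "'z set \<Rightarrow> ('z \<Rightarrow> nat) set \<Rightarrow> enat" where
  "VC Z H = Sup {enat (card D) | D. D \<subseteq> Z \<and> finite D \<and> shatters H D}"

definition sign01 :: "real \<Rightarrow> nat" where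
  "sign01 z = (if z > 0 then 1 else 0)"

definition loss_concept :: "('y \<Rightarrow> 'y \<Rightarrow> real) \<Rightarrow> ('x \<Rightarrow> 'y) \<Rightarrow> 'x \<times> 'y \<times> real \<Rightarrow> nat" where
  "loss_concept L f = (\<lambda>(x, y, \<rho>). sign01 (L (f x) y - \<rho>))"

definition pseudo_dim ::
    "'x set \<Rightarrow> 'y set \<Rightarrow> ('x \<Rightarrow> 'y) set \<Rightarrow> ('y \<Rightarrow> 'y \<Rightarrow> real) \<Rightarrow> enat" where
  "pseudo_dim X Y F L = VC (X \<times> Y \<times> UNIV) (loss_concept L ` F)"

definition lin_indep_on :: "'a set \<Rightarrow> ('k::finite \<Rightarrow> 'a \<Rightarrow> real) \<Rightarrow> bool" where
  "lin_indep_on S \<omega> \<longleftrightarrow>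
     (\<forall>c :: 'k \<Rightarrow> real. (\<forall>t\<in>S. (\<Sum>j\<in>UNIV. c j * \<omega> j t) = 0) \<longrightarrow> (\<forall>j. c j = 0))"

definition basis_inputs ::
    "('k::finite \<Rightarrow> nat) \<Rightarrow> ('k \<Rightarrow> real) \<Rightarrow> ('k \<Rightarrow> real) \<Rightarrow> ('k \<Rightarrow> real \<Rightarrow> real) \<Rightarrow> bool" where
  "basis_inputs l \<alpha> \<beta> \<omega> \<longleftrightarrow>
     lin_indep_on {0..1} \<omega> \<and>
     (\<forall>j. (\<forall>t\<in>{0..1}. \<omega> j t = t ^ l j * exp (\<alpha> j * t) * sin (\<beta> j * t)) \<or>
          (\<forall>t\<in>{0..1}. \<omega> j t = t ^ l j * exp (\<alpha> j * t) * cos (\<beta> j * t)))"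

text \<open>Controls are functions on \<open>[0,1]\<close>: two of them are identified when they agree there,
  which is what \<open>restrict\<close> enforces.\<close>

definition input_space :: "('k::finite \<Rightarrow> real \<Rightarrow> real) \<Rightarrow> (real \<Rightarrow> real ^ 'm::finite) set" where
  "input_space \<omega> = {restrict (\<lambda>t. G *v (\<chi> j. \<omega> j t)) {0..1} | G :: real ^ 'k ^ 'm. True}"

definition state_trajectory ::
    "real ^ 'n ^ 'n \<Rightarrow> real ^ 'm ^ 'n \<Rightarrow> real ^ 'n \<Rightarrow> (real \<Rightarrow> real ^ 'm::finite) \<Rightarrow>
     (real \<Rightarrow> real ^ 'n::finite) \<Rightarrow> bool" where
  "state_trajectory A B x0 u x \<longleftrightarrow>
     x 0 = x0 \<and>
     (\<forall>t\<in>{0..1}. (x has_vector_derivative (A *v x t + B *v u t)) (at t within {0..1}))"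

text \<open>For continuous \<open>u\<close> the state trajectory exists and is unique on \<open>[0,1]\<close>, so
  the description below denotes \<open>y(1)\<close>.\<close>

definition final_output ::
    "real ^ 'n ^ 'n \<Rightarrow> real ^ 'm ^ 'n \<Rightarrow> real ^ 'n ^ 1 \<Rightarrow> real ^ 'n::finite \<Rightarrow>
     (real \<Rightarrow> real ^ 'm::finite) \<Rightarrow> real" where
  "final_output A B C x0 u =
     (THE y1. \<exists>x. state_trajectory A B x0 u x \<and> y1 = (C *v x 1) $ 1)"

text \<open>The state dimension does not occur in the type of the resulting maps, hence the
  \<open>itself\<close> argument.\<close>

definition system_class :: "'n::finite itself \<Rightarrow> ((real \<Rightarrow> real ^ 'm::finite) \<Rightarrow> real) set" where
  "system_class _ =
     {final_output A B C x0 | (A :: real ^ 'n ^ 'n) (B :: real ^ 'm ^ 'n) (C :: real ^ 'n ^ 1)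
        (x0 :: real ^ 'n). True}"

end

theory Submission
  imports Defs
begin

text \<open>For a control \<open>u = G\<omega>\<close>, the final output of a system is a rational function of \<open>A\<close>, \<open>E = e\<^sup>A\<close>, \<open>B\<close>, \<open>C\<close>, \<open>x\<^sup>0\<close>,
provided that no \<open>\<mu>\<^sub>j = \<alpha>\<^sub>j + i\<beta>\<^sub>j\<close> is an eigenvalue of \<open>A\<close>: the equation \<open>x' = Ax + t\<^sup>l e\<^sup>\<mu>\<^sup>t b\<close> has a
particular solution built from powers of the resolvent \<open>(A - \<mu>I)\<^sup>-\<^sup>1 = adj(A - \<mu>I) / det(A - \<mu>I)\<close>
(\<open>final_output_quasi_poly_input\<close>, \<open>output_rational\<close>). The entries of \<open>E\<close> are treated as
additional independent variables, so there are \<open>2n\<^sup>2 + nm + 2n\<close> real parameters, and no Jordan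
form is needed.

If a set of \<open>V\<close> points is shattered, choose one system for each of the \<open>2\<^sup>V\<close> dichotomies. These are
finitely many systems, and so the conditions that a loss exceeds its threshold can be
made strict with a uniform margin, and all resonances are removed by replacing each \<open>\<mu>\<^sub>j\<close> by \<open>\<mu>\<^sub>j + \<delta>\<close>
for one small \<open>\<delta>\<close>; by variation of constants the outputs depend continuously on \<open>\<delta>\<close>
(\<open>final_output_exp_weight_tendsto\<close>). After clearing denominators, the \<open>2\<^sup>V\<close> parameter vectors
realise distinct strict sign vectors of \<open>V\<close> polynomials of degree at most \<open>d = 4nk(l\<^sub>m\<^sub>a\<^sub>x + 1) + 6\<close>
(\<open>shattered_set_bound\<close>).

The number of strict sign vectors of \<open>V\<close> polynomials of degree \<open>\<le> d\<close> in \<open>p\<close> variables is at most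
\<open>2 e\<^sup>p\<close> for odd \<open>e \<ge> V d\<close> (\<open>card_sign_patterns_le\<close>): each occurring sign cell contains a critical
point of \<open>\<plusminus>\<Prod>P\<^sub>i - \<epsilon> \<Sum>x\<^sub>i\<^sup>e\<^sup>+\<^sup>1\<close>, and the critical point equations have the form \<open>x\<^sub>i\<^sup>e = q\<^sub>i(x)\<close> with
\<open>deg q\<^sub>i < e\<close>, so that they have at most \<open>e\<^sup>p\<close> solutions (\<open>card_zeros_le\<close>).
Hence \<open>2\<^sup>V \<le> 2 (V d + 1)\<^sup>p\<close>, and solving for \<open>V\<close> (\<open>le_log_of_exp_le_poly\<close>,
\<open>degree_times_dimension_bound\<close>) gives the bound.\<close>

section \<open>Polynomial functions and zeros of systems with pure leading powers\<close>

text \<open>Polynomial functions of total degree at most \<open>d\<close> on \<open>\<real>\<^sup>p\<close>, with values in a normed field. Taking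
  multiplication by a single coordinate as the generating step makes derivatives, growth bounds and
  the reduction of monomials provable by rule induction; closure under products is derived.\<close>

inductive poly_fun :: "nat \<Rightarrow> (real ^ 'p \<Rightarrow> 'b::real_normed_field) \<Rightarrow> bool" where
  const: "poly_fun d (\<lambda>_. c)"
| add: "poly_fun d f \<Longrightarrow> poly_fun d g \<Longrightarrow> poly_fun d (\<lambda>x. f x + g x)"
| coord: "poly_fun d f \<Longrightarrow> poly_fun (Suc d) (\<lambda>x. of_real (x $ i) * f x)"

lemma poly_fun_mono: "poly_fun d f \<Longrightarrow> d \<le> d' \<Longrightarrow> poly_fun d' f"
proof (induction arbitrary: d' rule: poly_fun.induct)
  case (coord d f i)
  then obtain d'' where "d' = Suc d''" "d \<le> d''"
    by (metis Suc_le_D Suc_le_mono)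
  with coord show ?case by (auto intro: poly_fun.coord)
qed (auto intro: poly_fun.intros)

lemma poly_fun_coord1: "1 \<le> d \<Longrightarrow> poly_fun d (\<lambda>x. of_real (x $ i))"
  using poly_fun_mono[OF poly_fun.coord[OF poly_fun.const[of 0 1], of i], of d] by simp

lemma poly_fun_real_coord1: "1 \<le> d \<Longrightarrow> poly_fun d (\<lambda>x. x $ i)"
  using poly_fun_coord1[of d i, where 'b=real] by simp

lemma poly_fun_scale: "poly_fun d f \<Longrightarrow> poly_fun d (\<lambda>x. c * f x)"
proof (induction rule: poly_fun.induct)
  case (coord d f i)
  then have "poly_fun (Suc d) (\<lambda>x. of_real (x $ i) * (c * f x))" by (auto intro: poly_fun.coord)
  then show ?case by (simp add: mult.left_commute)
qed (auto intro: poly_fun.intros simp: distrib_left)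

lemma poly_fun_mult: "poly_fun d f \<Longrightarrow> poly_fun e g \<Longrightarrow> poly_fun (d + e) (\<lambda>x. f x * g x)"
proof (induction rule: poly_fun.induct)
  case (const d c)
  then show ?case by (intro poly_fun_mono[OF poly_fun_scale]) auto
next
  case (add d f g)
  then show ?case by (auto intro: poly_fun.add simp: distrib_right)
next
  case (coord d f i)
  then show ?case by (auto intro: poly_fun.coord simp: mult.assoc)
qed

lemma poly_fun_mult': "poly_fun d f \<Longrightarrow> poly_fun e g \<Longrightarrow> d + e \<le> k \<Longrightarrow> poly_fun k (\<lambda>x. f x * g x)"
  using poly_fun_mult poly_fun_mono by blast

lemma poly_fun_uminus: "poly_fun d f \<Longrightarrow> poly_fun d (\<lambda>x. - f x)"
  using poly_fun_scale[of d f "-1"] by simp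

lemma poly_fun_diff: "poly_fun d f \<Longrightarrow> poly_fun d g \<Longrightarrow> poly_fun d (\<lambda>x. f x - g x)"
  using poly_fun.add[OF _ poly_fun_uminus] by fastforce

lemma poly_fun_sum: "(\<And>i. i \<in> I \<Longrightarrow> poly_fun d (f i)) \<Longrightarrow> poly_fun d (\<lambda>x. \<Sum>i\<in>I. f i x)"
  by (induction I rule: infinite_finite_induct) (auto intro: poly_fun.intros)

lemma poly_fun_prod:
  "(\<And>i. i \<in> I \<Longrightarrow> poly_fun (d i) (f i)) \<Longrightarrow> poly_fun (\<Sum>i\<in>I. d i) (\<lambda>x. \<Prod>i\<in>I. f i x)"
  by (induction I rule: infinite_finite_induct) (auto intro: poly_fun.const poly_fun_mult)

lemma poly_fun_power: "poly_fun d f \<Longrightarrow> poly_fun (d * n) (\<lambda>x. f x ^ n)"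
  by (induction n) (auto intro: poly_fun.const poly_fun_mult)

lemma poly_fun_continuous: "poly_fun d (f :: real ^ 'p \<Rightarrow> 'b::real_normed_field) \<Longrightarrow> continuous_on UNIV f"
  by (induction rule: poly_fun.induct) (auto intro!: continuous_intros)

text \<open>The truncated difference \<open>d - 1\<close> is harmless for \<open>d = 0\<close>, but the induction for multiplication by a
  coordinate needs to know that the derivative then vanishes.\<close>

lemma poly_fun_partial_derivative:
  fixes f :: "real ^ 'p \<Rightarrow> real"
  assumes "poly_fun d f"
  shows "\<exists>g. poly_fun (d - 1) g \<and> (d = 0 \<longrightarrow> g = (\<lambda>_. 0)) \<and>
           (\<forall>x. ((\<lambda>t. f (x + t *\<^sub>R axis i 1)) has_real_derivative g x) (at 0))"
  using assms
proof (induction rule: poly_fun.induct)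
  case (const d c)
  then show ?case by (intro exI[of _ "\<lambda>_. 0"]) (auto intro: poly_fun.const)
next
  case (add d f g)
  then obtain f' g' where
    "poly_fun (d - 1) f'" "d = 0 \<longrightarrow> f' = (\<lambda>_. 0)"
    "\<And>x. ((\<lambda>t. f (x + t *\<^sub>R axis i 1)) has_real_derivative f' x) (at 0)"
    "poly_fun (d - 1) g'" "d = 0 \<longrightarrow> g' = (\<lambda>_. 0)"
    "\<And>x. ((\<lambda>t. g (x + t *\<^sub>R axis i 1)) has_real_derivative g' x) (at 0)"
    by blast
  then show ?case
    by (intro exI[of _ "\<lambda>x. f' x + g' x"]) (auto intro: poly_fun.add DERIV_add)
next
  case (coord d f j)
  then obtain f' where f': "poly_fun (d - 1) f'" "d = 0 \<longrightarrow> f' = (\<lambda>_. 0)"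
    "\<And>x. ((\<lambda>t. f (x + t *\<^sub>R axis i 1)) has_real_derivative f' x) (at 0)"
    by blast
  let ?c = "(axis i 1 :: real ^ 'p) $ j"
  let ?g = "\<lambda>x. ?c * f x + x $ j * f' x"
  have "poly_fun d (\<lambda>x. x $ j * f' x)"
  proof (cases d)
    case 0
    then show ?thesis using f' by (auto intro: poly_fun.const)
  next
    case (Suc d')
    then show ?thesis using f' poly_fun.coord[of d' f' j] by simp
  qed
  then have "poly_fun d ?g"
    by (intro poly_fun.add poly_fun_scale coord)
  moreover have "((\<lambda>t. of_real ((x + t *\<^sub>R axis i 1) $ j) * f (x + t *\<^sub>R axis i 1))
      has_real_derivative ?g x) (at 0)" for x
    by (auto intro!: derivative_eq_intros f')
  ultimately show ?case by (intro exI[of _ ?g]) auto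
qed

lemma poly_fun_growth:
  fixes f :: "real ^ 'p \<Rightarrow> real"
  assumes "poly_fun d f"
  shows "\<exists>C\<ge>0. \<forall>x. \<bar>f x\<bar> \<le> C * (1 + norm x) ^ d"
  using assms
proof (induction rule: poly_fun.induct)
  case (const d c)
  have "\<bar>c\<bar> * 1 \<le> \<bar>c\<bar> * (1 + norm x) ^ d" for x :: "real ^ 'p"
    by (intro mult_left_mono one_le_power) auto
  then show ?case by (intro exI[of _ "\<bar>c\<bar>"]) auto
next
  case (add d f g)
  then obtain C D where "C \<ge> 0" "D \<ge> 0" "\<And>x. \<bar>f x\<bar> \<le> C * (1 + norm x) ^ d" "\<And>x. \<bar>g x\<bar> \<le> D * (1 + norm x) ^ d"
    by blast
  then show ?case
    by (intro exI[of _ "C + D"]) (auto simp: distrib_right intro!: order.trans[OF abs_triangle_ineq] add_mono)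
next
  case (coord d f i)
  then obtain C where C: "C \<ge> 0" "\<And>x. \<bar>f x\<bar> \<le> C * (1 + norm x) ^ d" by blast
  have "\<bar>x $ i * f x\<bar> \<le> C * (1 + norm x) ^ Suc d" for x
  proof -
    have "\<bar>x $ i * f x\<bar> \<le> (1 + norm x) * (C * (1 + norm x) ^ d)"
      unfolding abs_mult
      by (intro mult_mono C order.trans[OF component_le_norm_cart]) auto
    then show ?thesis by (simp add: mult_ac)
  qed
  with C show ?case by auto
qed

text \<open>A homogeneous linear system with more unknowns \<open>c z\<close> than equations has a nontrivial solution.\<close>

lemma underdetermined_system:
  fixes M :: "'w \<Rightarrow> 'z \<Rightarrow> real"
  assumes "finite W" "finite Z" "card W < card Z"
  shows "\<exists>c. (\<exists>z\<in>Z. c z \<noteq> 0) \<and> (\<forall>w\<in>W. (\<Sum>z\<in>Z. c z * M w z) = 0)"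
  using assms
proof (induction W arbitrary: Z M rule: finite_induct)
  case empty
  then obtain z where "z \<in> Z" by (metis card.empty less_nat_zero_code ex_in_conv)
  then show ?case by (intro exI[of _ "\<lambda>_. 1"]) auto
next
  case (insert w W)
  show ?case
  proof (cases "\<forall>z\<in>Z. M w z = 0")
    case True
    with insert.IH[of Z M] insert.prems insert.hyps show ?thesis by auto
  next
    case False
    then obtain z0 where z0: "z0 \<in> Z" "M w z0 \<noteq> 0" by blast
    let ?Z = "Z - {z0}"
    define M' where "M' v z = M v z - M v z0 * M w z / M w z0" for v z
    have "card W < card ?Z" using insert z0 by (simp add: card_Diff_singleton)
    then obtain c where c: "\<exists>z\<in>?Z. c z \<noteq> 0" "\<And>v. v \<in> W \<Longrightarrow> (\<Sum>z\<in>?Z. c z * M' v z) = 0"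
      using insert.IH[of ?Z M'] insert.prems by auto
    define c0 where "c0 = - (\<Sum>z\<in>?Z. c z * M w z) / M w z0"
    define c' where "c' = c(z0 := c0)"
    have split: "(\<Sum>z\<in>Z. c' z * M v z) = c0 * M v z0 + (\<Sum>z\<in>?Z. c z * M v z)" for v
      using z0 insert.prems by (subst sum.remove[of _ z0]) (auto simp: c'_def intro!: sum.cong)
    have "(\<Sum>z\<in>Z. c' z * M w z) = 0"
      unfolding split using z0 by (simp add: c0_def)
    moreover have "(\<Sum>z\<in>Z. c' z * M v z) = 0" if "v \<in> W" for v
    proof -
      have "0 = (\<Sum>z\<in>?Z. c z * M' v z)" using c that by simp
      also have "\<dots> = (\<Sum>z\<in>?Z. c z * M v z) - M v z0 / M w z0 * (\<Sum>z\<in>?Z. c z * M w z)"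
        by (simp add: M'_def right_diff_distrib sum_subtractf sum_distrib_left mult_ac)
      finally show ?thesis unfolding split by (simp add: c0_def)
    qed
    moreover have "\<exists>z\<in>Z. c' z \<noteq> 0" using c(1) by (auto simp: c'_def)
    ultimately show ?thesis by (intro exI[of _ c']) auto
  qed
qed

text \<open>The monomial function with exponent vector \<open>a\<close>.\<close>

definition monomial :: "('p::finite \<Rightarrow> nat) \<Rightarrow> real ^ 'p \<Rightarrow> real" where
  "monomial a x = (\<Prod>i\<in>UNIV. x $ i ^ a i)"

lemma monomial_zero [simp]: "monomial (\<lambda>_. 0) x = 1"
  by (simp add: monomial_def)

lemma monomial_Suc: "monomial (a(i := Suc (a i))) x = x $ i * monomial a x"
  unfolding monomial_def
  by (subst (1 2) prod.remove[of _ i]) (auto intro!: prod.cong)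

lemma monomial_split:
  assumes "e \<le> a i"
  shows "monomial a x = x $ i ^ e * monomial (a(i := a i - e)) x"
proof -
  have "x $ i ^ a i = x $ i ^ e * x $ i ^ (a i - e)"
    using assms by (simp flip: power_add)
  then show ?thesis
    unfolding monomial_def
    by (subst (1 2) prod.remove[of _ i]) (auto intro!: prod.cong)
qed

lemma poly_fun_monomial: "poly_fun (\<Sum>i\<in>UNIV. a i) (monomial a)"
proof -
  have "poly_fun (\<Sum>i\<in>UNIV. 1 * a i) (\<lambda>x. \<Prod>i\<in>UNIV. x $ i ^ a i)"
    by (intro poly_fun_prod poly_fun_power poly_fun_real_coord1) auto
  then show ?thesis by (simp add: monomial_def[abs_def])
qed

text \<open>Exponent vectors with all entries below \<open>e\<close>: when every \<open>x\<^sub>i\<^sup>e\<close> can be rewritten by terms of lower degree,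
  the corresponding monomials span all polynomials.\<close>

definition reduced_exponents :: "nat \<Rightarrow> ('p::finite \<Rightarrow> nat) set" where
  "reduced_exponents e = {a. \<forall>i. a i < e}"

lemma reduced_exponents_eq: "reduced_exponents e = (UNIV \<rightarrow>\<^sub>E {..<e})"
  by (auto simp: reduced_exponents_def PiE_def)

lemma finite_reduced_exponents [simp]: "finite (reduced_exponents e :: ('p::finite \<Rightarrow> nat) set)"
  unfolding reduced_exponents_eq by (intro finite_PiE) auto

lemma card_reduced_exponents: "card (reduced_exponents e :: ('p::finite \<Rightarrow> nat) set) = e ^ CARD('p)"
  unfolding reduced_exponents_eq by (subst card_PiE) auto

text \<open>On the point set \<open>Z\<close>, the function \<open>f\<close> is a linear combination of reduced monomials of total degree at
  most \<open>d\<close>. The degree bound is kept so that reduction can be iterated by induction on the degree.\<close>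

definition reduces_to :: "(real ^ 'p) set \<Rightarrow> nat \<Rightarrow> nat \<Rightarrow> (real ^ 'p \<Rightarrow> real) \<Rightarrow> bool" where
  "reduces_to Z e d f \<longleftrightarrow> (\<exists>c. \<forall>z\<in>Z. f z =
     (\<Sum>a \<in> {a \<in> reduced_exponents e. (\<Sum>i\<in>UNIV. a i) \<le> d}. c a * monomial a z))"

lemma finite_reduced_le [simp]: "finite {a \<in> reduced_exponents e. P (a :: 'p::finite \<Rightarrow> nat)}"
  by (rule finite_subset[OF _ finite_reduced_exponents[of e]]) auto

lemma reduces_to_monomial:
  assumes "a \<in> reduced_exponents e" "(\<Sum>i\<in>UNIV. a i) \<le> d"
  shows "reduces_to Z e d (monomial a)"
  unfolding reduces_to_def
  by (rule exI[of _ "\<lambda>b. if b = a then 1 else 0"])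
     (use assms in \<open>auto simp: if_distrib[of "\<lambda>u. u * _"] cong: if_cong\<close>)

lemma reduces_to_add:
  assumes "reduces_to Z e d f" "reduces_to Z e d g"
  shows "reduces_to Z e d (\<lambda>x. f x + g x)"
proof -
  obtain c1 c2 where "\<forall>z\<in>Z. f z = (\<Sum>a \<in> {a \<in> reduced_exponents e. (\<Sum>i\<in>UNIV. a i) \<le> d}. c1 a * monomial a z)"
     "\<forall>z\<in>Z. g z = (\<Sum>a \<in> {a \<in> reduced_exponents e. (\<Sum>i\<in>UNIV. a i) \<le> d}. c2 a * monomial a z)"
    using assms unfolding reduces_to_def by blast
  then show ?thesis unfolding reduces_to_def
    by (intro exI[of _ "\<lambda>a. c1 a + c2 a"]) (auto simp: distrib_right sum.distrib)
qed

lemma reduces_to_scale: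
  assumes "reduces_to Z e d f"
  shows "reduces_to Z e d (\<lambda>x. k * f x)"
proof -
  obtain c1 where "\<forall>z\<in>Z. f z = (\<Sum>a \<in> {a \<in> reduced_exponents e. (\<Sum>i\<in>UNIV. a i) \<le> d}. c1 a * monomial a z)"
    using assms unfolding reduces_to_def by blast
  then show ?thesis unfolding reduces_to_def
    by (intro exI[of _ "\<lambda>a. k * c1 a"]) (auto simp: sum_distrib_left mult_ac)
qed

lemma reduces_to_zero: "reduces_to Z e d (\<lambda>x. 0)"
  unfolding reduces_to_def by (rule exI[of _ "\<lambda>_. 0"]) auto

lemma reduces_to_sum:
  "(\<And>i. i \<in> I \<Longrightarrow> reduces_to Z e d (f i)) \<Longrightarrow> reduces_to Z e d (\<lambda>x. \<Sum>i\<in>I. f i x)"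
  by (induction I rule: infinite_finite_induct) (auto intro: reduces_to_zero reduces_to_add)

lemma reduces_to_mono:
  assumes "reduces_to Z e d f" "d \<le> d'"
  shows "reduces_to Z e d' f"
proof -
  obtain c where c: "\<forall>z\<in>Z. f z = (\<Sum>a \<in> {a \<in> reduced_exponents e. (\<Sum>i\<in>UNIV. a i) \<le> d}. c a * monomial a z)"
    using assms unfolding reduces_to_def by blast
  have "reduces_to Z e d' (\<lambda>z. \<Sum>a \<in> {a \<in> reduced_exponents e. (\<Sum>i\<in>UNIV. a i) \<le> d}. c a * monomial a z)"
    using assms(2) by (intro reduces_to_sum reduces_to_scale reduces_to_monomial) auto
  with c show ?thesis unfolding reduces_to_def by simp
qed

lemma reduces_to_cong:
  "(\<And>z. z \<in> Z \<Longrightarrow> f z = g z) \<Longrightarrow> reduces_to Z e d f \<longleftrightarrow> reduces_to Z e d g"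
  unfolding reduces_to_def by simp

text \<open>Where the relations \<open>x\<^sub>i\<^sup>e = q\<^sub>i(x)\<close> with \<open>deg q\<^sub>i < e\<close> hold, each replacement of \<open>x\<^sub>i\<^sup>e\<close> by \<open>q\<^sub>i\<close> strictly
  lowers the degree, so every polynomial reduces.\<close>

lemma poly_fun_reduces_to:
  fixes Z :: "(real ^ 'p) set" and q :: "'p \<Rightarrow> real ^ 'p \<Rightarrow> real"
  assumes e: "e \<ge> 1" and q: "\<And>i. poly_fun (e - 1) (q i)"
    and Z: "\<And>z i. z \<in> Z \<Longrightarrow> z $ i ^ e = q i z"
    and f: "poly_fun d f"
  shows "reduces_to Z e d f"
  using f
proof (induction d arbitrary: f rule: less_induct)
  case (less d)
  have "poly_fun d f \<Longrightarrow> (\<forall>d'<d. \<forall>g. poly_fun d' g \<longrightarrow> reduces_to Z e d' g) \<Longrightarrow> reduces_to Z e d f" for d f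
  proof (induction rule: poly_fun.induct)
    case (const d c)
    have "reduces_to Z e d (monomial (\<lambda>_. 0))"
      using e by (intro reduces_to_monomial) (auto simp: reduced_exponents_def)
    from reduces_to_scale[OF this, of c] show ?case by simp
  next
    case (add d f g)
    then show ?case by (auto intro: reduces_to_add)
  next
    case (coord d f i)
    then have "reduces_to Z e d f" by auto
    then obtain c where c: "\<And>z. z \<in> Z \<Longrightarrow> f z = (\<Sum>a \<in> {a \<in> reduced_exponents e. (\<Sum>i\<in>UNIV. a i) \<le> d}. c a * monomial a z)"
      unfolding reduces_to_def by blast
    \<comment> \<open>Multiplying by \<open>x\<^sub>i\<close> leaves the reduced range only if the exponent reaches \<open>e\<close> exactly.\<close>
    have mon: "reduces_to Z e (Suc d) (\<lambda>x. x $ i * monomial a x)"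
      if a: "a \<in> reduced_exponents e" "(\<Sum>i\<in>UNIV. a i) \<le> d" for a
    proof -
      define b where "b = a(i := Suc (a i))"
      have b: "(\<Sum>j\<in>UNIV. b j) = Suc (\<Sum>j\<in>UNIV. a j)"
        unfolding b_def by (subst (1 2) sum.remove[of _ i]) (auto intro!: sum.cong)
      have bx: "x $ i * monomial a x = monomial b x" for x
        by (simp add: b_def monomial_Suc)
      show ?thesis
      proof (cases "Suc (a i) < e")
        case True
        then have "b \<in> reduced_exponents e"
          using a by (auto simp: b_def reduced_exponents_def)
        then show ?thesis unfolding bx[abs_def]
          using b a by (intro reduces_to_monomial) auto
      next
        case False
        then have ai: "b i = e" using a by (auto simp: reduced_exponents_def b_def) (meson le_less_Suc_eq not_less_eq less_Suc_eq)
        define b' where "b' = b(i := b i - e)"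
        have "(\<Sum>j\<in>UNIV. b j) = e + (\<Sum>j\<in>UNIV. b' j)"
          unfolding b'_def using ai by (subst (1 2) sum.remove[of _ i]) (auto intro!: sum.cong)
        then have "(\<Sum>j\<in>UNIV. b' j) + (e - 1) \<le> d" using a b e by linarith
        then have "poly_fun d (\<lambda>x. monomial b' x * q i x)"
          by (intro poly_fun_mult'[OF poly_fun_monomial q])
        then have "reduces_to Z e d (\<lambda>x. monomial b' x * q i x)" using coord by auto
        moreover have "monomial b' z * q i z = z $ i * monomial a z" if "z \<in> Z" for z
          using monomial_split[of e b i z] ai Z[OF that, of i] by (simp add: b'_def bx mult_ac)
        ultimately show ?thesis
          using reduces_to_mono[of Z e d _ "Suc d"] reduces_to_cong[of Z "\<lambda>x. monomial b' x * q i x"] by simp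
      qed
    qed
    have "reduces_to Z e (Suc d) (\<lambda>x. \<Sum>a \<in> {a \<in> reduced_exponents e. (\<Sum>i\<in>UNIV. a i) \<le> d}. c a * (x $ i * monomial a x))"
      by (intro reduces_to_sum reduces_to_scale mon) auto
    moreover have "of_real (z $ i) * f z = (\<Sum>a \<in> {a \<in> reduced_exponents e. (\<Sum>i\<in>UNIV. a i) \<le> d}. c a * (z $ i * monomial a z))"
      if "z \<in> Z" for z
      using c[OF that] by (simp add: sum_distrib_left mult_ac)
    ultimately show ?case
      using reduces_to_cong by (metis (no_types, lifting))
  qed
  with less show ?case by blast
qed

text \<open>Lagrange interpolation at one point of a finite set.\<close>

lemma separating_poly_fun:
  fixes Z :: "(real ^ 'p) set"
  assumes "finite Z" "z \<notin> Z"
  shows "\<exists>d g. poly_fun d g \<and> g z = (1::real) \<and> (\<forall>w\<in>Z. g w = 0)"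
  using assms
proof (induction Z rule: finite_induct)
  case empty
  then show ?case by (auto intro!: exI[of _ "\<lambda>_. 1"] poly_fun.const)
next
  case (insert w Z)
  then obtain d g where g: "poly_fun d g" "g z = (1::real)" "\<forall>w\<in>Z. g w = 0" by auto
  from insert have "z \<noteq> w" by auto
  then obtain i where i: "z $ i \<noteq> w $ i" by (auto simp: vec_eq_iff)
  have "poly_fun (d + 1) (\<lambda>x. g x * (inverse (z $ i - w $ i) * (x $ i - w $ i)))"
    using g(1) by (intro poly_fun_mult poly_fun_scale poly_fun_diff poly_fun_real_coord1 poly_fun.const) auto
  then show ?case using g i by (intro exI[of _ "d + 1"] exI) auto
qed

text \<open>A Bezout bound for systems whose leading forms are pure powers. The functionals given by evaluation
  at distinct points are linearly independent on polynomials, while polynomials restricted to the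
  zero set are spanned by \<open>e\<^sup>p\<close> reduced monomials. No nondegeneracy of the zeros is needed.\<close>

lemma card_zeros_le:
  fixes Z :: "(real ^ 'p) set" and q :: "'p \<Rightarrow> real ^ 'p \<Rightarrow> real"
  assumes e: "e \<ge> 1" and q: "\<And>i. poly_fun (e - 1) (q i)"
    and Z: "\<And>z i. z \<in> Z \<Longrightarrow> z $ i ^ e = q i z" and fin: "finite Z"
  shows "card Z \<le> e ^ CARD('p)"
proof (rule ccontr)
  assume "\<not> ?thesis"
  then have "card (reduced_exponents e :: ('p \<Rightarrow> nat) set) < card Z"
    by (simp add: card_reduced_exponents)
  from underdetermined_system[OF finite_reduced_exponents fin this, of monomial]
  obtain c z where c: "z \<in> Z" "c z \<noteq> 0"
    and c0: "\<And>a :: 'p \<Rightarrow> nat. a \<in> reduced_exponents e \<Longrightarrow> (\<Sum>z\<in>Z. c z * monomial a z) = 0"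
    by auto
  obtain d g where g: "poly_fun d g" "g z = (1::real)" "\<forall>w\<in>Z - {z}. g w = 0"
    using separating_poly_fun[of "Z - {z}" z] fin by auto
  let ?R = "{a \<in> reduced_exponents e. (\<Sum>i\<in>UNIV. a i) \<le> d}"
  obtain k where k: "\<And>w. w \<in> Z \<Longrightarrow> g w = (\<Sum>a\<in>?R. k a * monomial a w)"
    using poly_fun_reduces_to[OF e q Z g(1)] unfolding reduces_to_def by blast
  have "c z = (\<Sum>w\<in>Z. c w * g w)"
    using fin c(1) g by (subst sum.remove[of _ z]) auto
  also have "\<dots> = (\<Sum>w\<in>Z. \<Sum>a\<in>?R. k a * (c w * monomial a w))"
    by (intro sum.cong) (auto simp: k sum_distrib_left mult_ac)
  also have "\<dots> = (\<Sum>a\<in>?R. k a * (\<Sum>w\<in>Z. c w * monomial a w))"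
    by (subst sum.swap) (simp add: sum_distrib_left)
  also have "\<dots> = 0" using c0 by auto
  finally show False using c by simp
qed

section \<open>Counting sign patterns\<close>

lemma norm_power_le_sum_power:
  fixes x :: "real ^ 'p"
  assumes "even k"
  shows "(norm x / CARD('p)) ^ k \<le> (\<Sum>i\<in>UNIV. x $ i ^ k)"
proof -
  have "\<exists>i. norm x / CARD('p) \<le> \<bar>x $ i\<bar>"
  proof (rule ccontr)
    assume "\<not> ?thesis"
    then have "(\<Sum>i\<in>UNIV. \<bar>x $ i\<bar>) < (\<Sum>i\<in>(UNIV::'p set). norm x / CARD('p))"
      by (intro sum_strict_mono) (auto simp: not_le)
    with norm_le_l1_cart[of x] show False by simp
  qed
  then obtain i where i: "norm x / CARD('p) \<le> \<bar>x $ i\<bar>" by blast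
  then have "(norm x / CARD('p)) ^ k \<le> \<bar>x $ i\<bar> ^ k"
    by (intro power_mono) auto
  also have "\<dots> = x $ i ^ k" using assms by (simp add: power_even_abs)
  also have "\<dots> \<le> (\<Sum>i\<in>UNIV. x $ i ^ k)"
    using assms by (intro member_le_sum) (auto simp: zero_le_even_power)
  finally show ?thesis .
qed

lemma bounded_superlevel_set:
  fixes f :: "real ^ 'p \<Rightarrow> real"
  assumes f: "poly_fun e f" and e: "odd e" and \<epsilon>: "\<epsilon> > 0"
  shows "bounded {x. f x - \<epsilon> * (\<Sum>i\<in>UNIV. x $ i ^ Suc e) \<ge> 0}"
proof -
  obtain C where C: "C \<ge> 0" "\<And>x. \<bar>f x\<bar> \<le> C * (1 + norm x) ^ e"
    using poly_fun_growth[OF f] by blast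
  define p where "p = real CARD('p)"
  have p: "p > 0" by (simp add: p_def)
  define R where "R = max 1 (C * 2 ^ e * p ^ Suc e / \<epsilon>)"
  have "norm x \<le> R" if x: "f x - \<epsilon> * (\<Sum>i\<in>UNIV. x $ i ^ Suc e) \<ge> 0" for x
  proof (cases "norm x \<le> 1")
    case False
    then have n: "norm x > 1" by simp
    have "\<epsilon> * (norm x / p) ^ Suc e \<le> \<epsilon> * (\<Sum>i\<in>UNIV. x $ i ^ Suc e)"
      unfolding p_def using e \<epsilon> by (intro mult_left_mono norm_power_le_sum_power) auto
    also have "\<dots> \<le> C * (1 + norm x) ^ e"
      using x C(2)[of x] by linarith
    also have "\<dots> \<le> C * (2 * norm x) ^ e"
      using n C by (intro mult_left_mono power_mono) auto
    finally have "\<epsilon> * (norm x / p) ^ Suc e \<le> C * (2 * norm x) ^ e" .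
    then have "\<epsilon> * norm x * norm x ^ e \<le> (C * 2 ^ e * p ^ Suc e) * norm x ^ e"
      using p by (simp add: power_divide power_mult_distrib field_simps)
    then have "\<epsilon> * norm x \<le> C * 2 ^ e * p ^ Suc e"
      by (rule mult_right_le_imp_le) (rule zero_less_power, use n in linarith)
    then have "norm x \<le> C * 2 ^ e * p ^ Suc e / \<epsilon>" using \<epsilon> by (simp add: field_simps)
    then show ?thesis by (simp add: R_def)
  qed (auto simp: R_def)
  then show ?thesis by (auto simp: bounded_iff)
qed

text \<open>Counting sign vectors \<open>(sgn P\<^sub>i)\<close> by critical points. Let \<open>f = \<sigma> \<Prod>P\<^sub>i\<close> be positive at a point of a cell
  (a set on which all \<open>P\<^sub>i\<close> have fixed signs). For small \<open>\<epsilon>\<close> the function \<open>f - \<epsilon> \<Sum>x\<^sub>i\<^sup>e\<^sup>+\<^sup>1\<close> is still positive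
  there, is nonpositive on the boundary of the cell and has bounded superlevel sets, since \<open>deg f \<le> e\<close>;
  hence it attains a maximum inside the cell. Critical points satisfy \<open>x\<^sub>i\<^sup>e = q\<^sub>i(x)\<close> with \<open>deg q\<^sub>i < e\<close>, so
  there are at most \<open>e\<^sup>p\<close> of them. Oddness of \<open>e\<close> makes the perturbation nonnegative.\<close>

lemma card_sign_patterns_fixed_product_sign_le:
  fixes P :: "'i \<Rightarrow> real ^ 'p \<Rightarrow> real" and \<sigma> :: real
  assumes I: "finite I" and P: "\<And>i. i \<in> I \<Longrightarrow> poly_fun d (P i)"
    and e: "odd e" "card I * d \<le> e"
    and S: "finite S" "\<And>x. x \<in> S \<Longrightarrow> \<sigma> * (\<Prod>i\<in>I. P i x) > 0"
    and inj: "inj_on (\<lambda>x. {i \<in> I. P i x > 0}) S"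
  shows "card S \<le> e ^ CARD('p)"
proof -
  define f where "f x = \<sigma> * (\<Prod>i\<in>I. P i x)" for x
  define Q where "Q x = (\<Sum>i\<in>UNIV. x $ i ^ Suc e)" for x :: "real ^ 'p"
  have Q0: "Q x \<ge> 0" for x unfolding Q_def using e by (intro sum_nonneg) (simp add: zero_le_even_power del: power_Suc)
  have fP: "poly_fun e f"
    using poly_fun_mono[OF poly_fun_scale[OF poly_fun_prod[of I "\<lambda>_. d" P]], of e \<sigma>] P e
    by (simp add: f_def[abs_def])
  have fcont: "continuous_on UNIV f" by (rule poly_fun_continuous[OF fP])
  have Pcont: "continuous_on UNIV (P i)" if "i \<in> I" for i
    using P that by (auto intro: poly_fun_continuous)
  obtain \<epsilon> where \<epsilon>: "\<epsilon> > 0" "\<And>x. x \<in> S \<Longrightarrow> f x - \<epsilon> * Q x > 0"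
  proof (cases "S = {}")
    case True
    then show ?thesis using that[of 1] by auto
  next
    case False
    define \<epsilon> where "\<epsilon> = Min ((\<lambda>x. f x / (1 + Q x)) ` S)"
    have "\<epsilon> > 0" unfolding \<epsilon>_def using S False Q0
      by (subst Min_gr_iff) (auto simp: f_def intro!: divide_pos_pos add_pos_nonneg)
    moreover have "f x - \<epsilon> * Q x > 0" if "x \<in> S" for x
    proof -
      have "\<epsilon> \<le> f x / (1 + Q x)" unfolding \<epsilon>_def using S that by (intro Min_le) auto
      then have "\<epsilon> * (1 + Q x) \<le> f x" using Q0[of x] by (simp add: field_simps)
      with \<open>\<epsilon> > 0\<close> show ?thesis by (simp add: distrib_left)
    qed
    ultimately show ?thesis using that by blast
  qed
  define h where "h x = f x - \<epsilon> * Q x" for x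
  have hcont: "continuous_on UNIV h"
    unfolding h_def Q_def by (intro continuous_intros fcont)
  have "\<exists>g. poly_fun (e - 1) g \<and>
      (\<forall>x. ((\<lambda>t. f (x + t *\<^sub>R axis i 1)) has_real_derivative g x) (at 0))" for i
    using poly_fun_partial_derivative[OF fP, of i] by blast
  then obtain g where g: "\<And>i. poly_fun (e - 1) (g i)"
    "\<And>i x. ((\<lambda>t. f (x + t *\<^sub>R axis i 1)) has_real_derivative g i x) (at 0)"
    by metis
  \<comment> \<open>The critical point equation solved for the pure power.\<close>
  define q where "q i x = inverse (\<epsilon> * Suc e) * g i x" for i x
  have q: "poly_fun (e - 1) (q i)" for i
    unfolding q_def by (intro poly_fun_scale g)
  have hder: "((\<lambda>t. h (x + t *\<^sub>R axis i 1)) has_real_derivative g i x - \<epsilon> * (Suc e * x $ i ^ e)) (at 0)" for i x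
  proof -
    have "((\<lambda>t. Q (x + t *\<^sub>R axis i 1)) has_real_derivative
       (\<Sum>j\<in>UNIV. Suc e * x $ j ^ e * (axis i 1 :: real ^ 'p) $ j)) (at 0)"
      unfolding Q_def by (auto intro!: derivative_eq_intros sum.cong simp del: power_Suc)
    also have "(\<Sum>j\<in>UNIV. Suc e * x $ j ^ e * (axis i 1 :: real ^ 'p) $ j) = Suc e * x $ i ^ e"
      by (subst sum.remove[of _ i]) (auto simp: axis_def)
    finally show ?thesis
      unfolding h_def by (auto intro!: derivative_eq_intros g)
  qed
  have "\<exists>z. (\<forall>i. z $ i ^ e = q i z) \<and> {i \<in> I. P i z > 0} = {i \<in> I. P i p > 0}" if p: "p \<in> S" for p
  proof -
    \<comment> \<open>\<open>U\<close> is the open cell of \<open>p\<close>, and \<open>K\<close> a compact set containing \<open>p\<close> on which \<open>h\<close> is maximised.\<close>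
    define U where "U = (\<Inter>i\<in>I. {x. P i p * P i x > 0})"
    define K where "K = (\<Inter>i\<in>I. {x. P i p * P i x \<ge> 0}) \<inter> {x. h x \<ge> 0}"
    have "closed K"
      unfolding K_def using I
      by (intro closed_Int closed_INT closed_Collect_le continuous_intros hcont Pcont ballI) auto
    moreover have "bounded K"
      using bounded_subset[OF bounded_superlevel_set[OF fP e(1) \<epsilon>(1)], of K]
      by (auto simp: K_def h_def Q_def)
    ultimately have "compact K" by (simp add: compact_eq_bounded_closed)
    moreover have pK: "p \<in> K" using \<epsilon>(2)[OF p] by (auto simp: K_def h_def intro: less_imp_le)
    ultimately obtain z where z: "z \<in> K" "\<And>x. x \<in> K \<Longrightarrow> h x \<le> h z"
      using continuous_attains_sup[of K h] continuous_on_subset[OF hcont] by (metis empty_iff subset_UNIV)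
    have hz: "h z > 0" using z(2)[OF pK] \<epsilon>(2)[OF p] by (simp add: h_def)
    then have "f z > 0" using Q0[of z] \<epsilon>(1) by (simp add: h_def) (smt (verit) mult_nonneg_nonneg)
    then have Pz: "P i z \<noteq> 0" if "i \<in> I" for i
      using \<open>f z > 0\<close> that prod_zero[OF I, of "\<lambda>i. P i z"] unfolding f_def by fastforce
    have Pp: "P i p \<noteq> 0" if "i \<in> I" for i
      using S(2)[OF p] that prod_zero[OF I, of "\<lambda>i. P i p"] by fastforce
    have zU: "z \<in> U" using z(1) Pz Pp by (auto simp: K_def U_def less_le)
    define V where "V = U \<inter> {x. h x > 0}"
    have "open V"
      unfolding V_def U_def using I
      by (intro open_Int open_INT open_Collect_less continuous_intros hcont Pcont ballI) auto
    moreover have zV: "z \<in> V" using zU hz by (simp add: V_def)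
    ultimately obtain r where r: "r > 0" "ball z r \<subseteq> V" by (auto simp: open_contains_ball)
    have VK: "V \<subseteq> K" by (auto simp: V_def U_def K_def intro: less_imp_le)
    have "z $ i ^ e = q i z" for i
    proof -
      have "h (z + t *\<^sub>R axis i 1) \<le> h z" if "\<bar>t\<bar> < r" for t
      proof -
        have "z + t *\<^sub>R axis i 1 \<in> ball z r"
          using that by (auto simp: dist_norm norm_axis_1)
        with r VK z show ?thesis by blast
      qed
      then have "g i z - \<epsilon> * (Suc e * z $ i ^ e) = 0"
        by (intro DERIV_local_max[OF hder r(1)]) auto
      then show ?thesis using \<epsilon>(1) by (simp add: q_def field_simps del: of_nat_Suc)
    qed
    moreover have "{i \<in> I. P i z > 0} = {i \<in> I. P i p > 0}"
      using zU by (auto simp: U_def zero_less_mult_iff)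
    ultimately show ?thesis by blast
  qed
  then have "\<forall>p\<in>S. \<exists>z. (\<forall>i. z $ i ^ e = q i z) \<and> {i \<in> I. P i z > 0} = {i \<in> I. P i p > 0}"
    by blast
  from bchoice[OF this] obtain \<zeta> where
    \<zeta>: "\<forall>p\<in>S. (\<forall>i. \<zeta> p $ i ^ e = q i (\<zeta> p)) \<and> {i \<in> I. P i (\<zeta> p) > 0} = {i \<in> I. P i p > 0}" ..
  have "inj_on \<zeta> S"
  proof (rule inj_onI)
    fix x y assume xy: "x \<in> S" "y \<in> S" "\<zeta> x = \<zeta> y"
    then have "{i \<in> I. P i x > 0} = {i \<in> I. P i y > 0}"
      using \<zeta>[THEN bspec, OF xy(1)] \<zeta>[THEN bspec, OF xy(2)] xy(3) by simp
    then show "x = y" using inj xy by (simp add: inj_on_def)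
  qed
  then have "card S = card (\<zeta> ` S)" by (simp add: card_image)
  also have "\<dots> \<le> e ^ CARD('p)"
    using e \<zeta> S by (intro card_zeros_le[of e q] q) (auto intro!: Suc_leI intro: Nat.gr0I)
  finally show ?thesis .
qed

text \<open>The number of strict sign vectors of finitely many polynomials: points with positive and with negative
  product are counted separately.\<close>

lemma card_sign_patterns_le:
  fixes P :: "'i \<Rightarrow> real ^ 'p \<Rightarrow> real"
  assumes I: "finite I" and P: "\<And>i. i \<in> I \<Longrightarrow> poly_fun d (P i)"
    and e: "odd e" "card I * d \<le> e"
    and S: "finite S" "\<And>x i. x \<in> S \<Longrightarrow> i \<in> I \<Longrightarrow> P i x \<noteq> 0"
    and inj: "inj_on (\<lambda>x. {i \<in> I. P i x > 0}) S"
  shows "card S \<le> 2 * e ^ CARD('p)"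
proof -
  define f where "f x = (\<Prod>i\<in>I. P i x)" for x
  have "f x \<noteq> 0" if "x \<in> S" for x using S(2)[OF that] I by (auto simp: f_def)
  then have S_eq: "S = {x \<in> S. f x > 0} \<union> {x \<in> S. f x < 0}" by force
  have "card {x \<in> S. f x > 0} \<le> e ^ CARD('p)"
    using S by (intro card_sign_patterns_fixed_product_sign_le[OF I P e, where \<sigma> = 1]) (auto simp: f_def intro: inj_on_subset[OF inj])
  moreover have "card {x \<in> S. f x < 0} \<le> e ^ CARD('p)"
    using S by (intro card_sign_patterns_fixed_product_sign_le[OF I P e, where \<sigma> = "-1"]) (auto simp: f_def intro: inj_on_subset[OF inj])
  moreover have "card S \<le> card {x \<in> S. f x > 0} + card {x \<in> S. f x < 0}"
    by (subst S_eq) (rule card_Un_le)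
  ultimately show ?thesis by linarith
qed

section \<open>Matrix exponentials and variation of constants\<close>

lemma has_vector_derivative_vec:
  fixes f :: "real \<Rightarrow> 'a::euclidean_space ^ 'n"
  assumes "\<And>i. ((\<lambda>t. f t $ i) has_vector_derivative f' $ i) (at x within S)"
  shows "(f has_vector_derivative f') (at x within S)"
  unfolding has_vector_derivative_def has_derivative_componentwise_within[of f]
proof
  fix b :: "'a ^ 'n" assume "b \<in> Basis"
  then obtain i c where b: "b = axis i c" by (auto simp: Basis_vec_def)
  have "((\<lambda>t. f t $ i \<bullet> c) has_derivative (\<lambda>h. (h *\<^sub>R f' $ i) \<bullet> c)) (at x within S)"
    using assms[of i] unfolding has_vector_derivative_def by (rule has_derivative_inner_left)
  then show "((\<lambda>t. f t \<bullet> b) has_derivative (\<lambda>h. (h *\<^sub>R f') \<bullet> b)) (at x within S)"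
    by (simp add: b inner_axis)
qed

lemma has_vector_derivative_vec_nth:
  assumes "(f has_vector_derivative f') F"
  shows "((\<lambda>t. f t $ i) has_vector_derivative f' $ i) F"
  by (rule bounded_linear.has_vector_derivative[OF bounded_linear_vec_nth assms])

lemma bounded_bilinear_matrix_vector_mult:
  "bounded_bilinear ((*v) :: real ^ 'n ^ 'm \<Rightarrow> real ^ 'n \<Rightarrow> real ^ 'm)"
  unfolding bilinear_conv_bounded_bilinear[symmetric] bilinear_def
  by (auto intro!: linearI simp: matrix_vector_mult_add_rdistrib matrix_vector_right_distrib
      matrix_vector_mult_scaleR scaleR_matrix_vector_assoc)

lemmas matrix_vector_has_vector_derivative =
  bounded_bilinear.has_vector_derivative[OF bounded_bilinear_matrix_vector_mult]

lemmas matrix_vector_mult_minus_left = bounded_bilinear.minus_left[OF bounded_bilinear_matrix_vector_mult]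
lemmas matrix_vector_mult_minus_right = bounded_bilinear.minus_right[OF bounded_bilinear_matrix_vector_mult]

lemmas continuous_on_matrix_vector_mult =
  bounded_bilinear.continuous_on[OF bounded_bilinear_matrix_vector_mult]

text \<open>Powers of a real square matrix with respect to the matrix product \<open>**\<close>.\<close>

primrec matrix_power :: "real ^ 'n ^ 'n \<Rightarrow> nat \<Rightarrow> real ^ 'n ^ 'n" where
  "matrix_power A 0 = mat 1"
| "matrix_power A (Suc k) = A ** matrix_power A k"

lemma matrix_power_commute: "matrix_power A k ** A = A ** matrix_power A k"
  by (induction k) (auto simp: matrix_mul_assoc[symmetric])

lemma matrix_power_bound:
  "\<bar>matrix_power A k $ i $ j\<bar> \<le> (\<Sum>i\<in>UNIV. \<Sum>j\<in>UNIV. \<bar>A $ i $ j\<bar>) ^ k"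
proof (induction k arbitrary: i)
  case 0
  then show ?case by (simp add: mat_def)
next
  case (Suc k)
  let ?K = "\<Sum>i\<in>UNIV. \<Sum>j\<in>UNIV. \<bar>A $ i $ j\<bar>"
  have "\<bar>matrix_power A (Suc k) $ i $ j\<bar> \<le> (\<Sum>h\<in>UNIV. \<bar>A $ i $ h\<bar> * ?K ^ k)"
    by (auto simp: matrix_matrix_mult_def abs_mult intro!: order.trans[OF sum_abs] sum_mono mult_left_mono Suc)
  also have "\<dots> = (\<Sum>h\<in>UNIV. \<bar>A $ i $ h\<bar>) * ?K ^ k" by (simp add: sum_distrib_right)
  also have "\<dots> \<le> ?K * ?K ^ k"
    by (intro mult_right_mono member_le_sum[of i UNIV "\<lambda>i. \<Sum>h\<in>UNIV. \<bar>A $ i $ h\<bar>"] zero_le_power sum_nonneg) (auto intro: sum_nonneg)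
  finally show ?case by simp
qed

lemma summable_matrix_exp:
  "summable (\<lambda>k. (matrix_power A k $ i $ j / fact k) * (t::real) ^ k)"
proof (rule summable_comparison_test')
  let ?K = "\<Sum>i\<in>UNIV. \<Sum>j\<in>UNIV. \<bar>A $ i $ j\<bar>"
  show "summable (\<lambda>k. inverse (fact k) * (?K * \<bar>t\<bar>) ^ k)" by (rule summable_exp)
  show "norm ((matrix_power A k $ i $ j / fact k) * t ^ k) \<le> inverse (fact k) * (?K * \<bar>t\<bar>) ^ k" if "k \<ge> 0" for k
    using mult_right_mono[OF matrix_power_bound[of A k i j], of "\<bar>t\<bar> ^ k"]
    by (simp add: abs_mult power_abs power_mult_distrib divide_simps)
qed

text \<open>The matrix exponential \<open>e\<^sup>t\<^sup>A\<close>, defined entrywise by its power series in \<open>t\<close>, so that termwise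
  differentiation of real power series applies.\<close>

definition matrix_exp :: "real ^ 'n ^ 'n \<Rightarrow> real \<Rightarrow> real ^ 'n ^ 'n" where
  "matrix_exp A t = (\<chi> i j. \<Sum>k. (matrix_power A k $ i $ j / fact k) * t ^ k)"

lemma matrix_exp_0 [simp]: "matrix_exp A 0 = mat 1"
  unfolding matrix_exp_def by (subst powser_zero) (simp add: vec_eq_iff)

lemma matrix_exp_entry_derivative:
  "((\<lambda>t. matrix_exp A t $ i $ j) has_real_derivative
     (\<Sum>k. (matrix_power A (Suc k) $ i $ j / fact k) * t ^ k)) (at t)"
proof -
  have "diffs (\<lambda>k. matrix_power A k $ i $ j / fact k) = (\<lambda>k. matrix_power A (Suc k) $ i $ j / fact k)"
    by (rule ext) (simp add: diffs_def field_simps del: of_nat_Suc matrix_power.simps)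
  then show ?thesis
    using termdiffs_strong_converges_everywhere[OF summable_matrix_exp[of A i j]]
    unfolding matrix_exp_def by simp
qed

lemma matrix_exp_has_vector_derivative:
  "(matrix_exp A has_vector_derivative A ** matrix_exp A t) (at t within S)"
proof -
  have "(\<Sum>k. (matrix_power A (Suc k) $ i $ j / fact k) * t ^ k) = (A ** matrix_exp A t) $ i $ j" for i j
  proof -
    have "(\<Sum>k. (matrix_power A (Suc k) $ i $ j / fact k) * t ^ k) =
        (\<Sum>k. \<Sum>h\<in>UNIV. A $ i $ h * ((matrix_power A k $ h $ j / fact k) * t ^ k))"
      by (simp add: matrix_matrix_mult_def sum_divide_distrib sum_distrib_right mult.assoc)
    also have "\<dots> = (\<Sum>h\<in>UNIV. \<Sum>k. A $ i $ h * ((matrix_power A k $ h $ j / fact k) * t ^ k))"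
      by (rule suminf_sum) (rule summable_mult[OF summable_matrix_exp])
    also have "\<dots> = (A ** matrix_exp A t) $ i $ j"
      by (simp add: matrix_exp_def matrix_matrix_mult_def suminf_mult[OF summable_matrix_exp]
          del: times_divide_eq_left times_divide_eq_right)
    finally show ?thesis .
  qed
  then have "((\<lambda>t. matrix_exp A t $ i $ j) has_vector_derivative (A ** matrix_exp A t) $ i $ j) (at t within S)" for i j
    using matrix_exp_entry_derivative[of A i j t]
    by (auto simp: has_real_derivative_iff_has_vector_derivative[symmetric] intro: has_field_derivative_at_within)
  then show ?thesis by (intro has_vector_derivative_vec)
qed

lemma matrix_exp_commute: "matrix_exp A t ** A = A ** matrix_exp A t"
proof -
  have "(matrix_exp A t ** A) $ i $ j = (A ** matrix_exp A t) $ i $ j" for i j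
  proof -
    have "(matrix_exp A t ** A) $ i $ j = (\<Sum>h\<in>UNIV. \<Sum>k. ((matrix_power A k $ i $ h / fact k) * t ^ k) * A $ h $ j)"
      by (simp add: matrix_exp_def matrix_matrix_mult_def suminf_mult2[OF summable_matrix_exp]
          del: times_divide_eq_left times_divide_eq_right)
    also have "\<dots> = (\<Sum>k. \<Sum>h\<in>UNIV. ((matrix_power A k $ i $ h / fact k) * t ^ k) * A $ h $ j)"
      by (rule suminf_sum[symmetric]) (rule summable_mult2[OF summable_matrix_exp])
    also have "\<dots> = (\<Sum>k. ((matrix_power A k ** A) $ i $ j / fact k) * t ^ k)"
      by (simp add: matrix_matrix_mult_def sum_divide_distrib sum_distrib_left sum_distrib_right mult_ac)
    also have "\<dots> = (\<Sum>k. \<Sum>h\<in>UNIV. A $ i $ h * ((matrix_power A k $ h $ j / fact k) * t ^ k))"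
      unfolding matrix_power_commute
      by (simp add: matrix_matrix_mult_def sum_divide_distrib sum_distrib_right mult.assoc)
    also have "\<dots> = (\<Sum>h\<in>UNIV. \<Sum>k. A $ i $ h * ((matrix_power A k $ h $ j / fact k) * t ^ k))"
      by (rule suminf_sum) (rule summable_mult[OF summable_matrix_exp])
    also have "\<dots> = (A ** matrix_exp A t) $ i $ j"
      by (simp add: matrix_exp_def matrix_matrix_mult_def suminf_mult[OF summable_matrix_exp]
          del: times_divide_eq_left times_divide_eq_right)
    finally show ?thesis .
  qed
  then show ?thesis by (simp add: vec_eq_iff)
qed

lemma matrix_exp_minus_has_vector_derivative:
  "((\<lambda>t. matrix_exp A (- t)) has_vector_derivative - (matrix_exp A (- t) ** A)) (at t within S)"
proof -
  have "(uminus has_vector_derivative (-1::real)) (at t within S)"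
    by (auto intro!: derivative_eq_intros simp flip: has_real_derivative_iff_has_vector_derivative)
  from vector_diff_chain_within[OF this matrix_exp_has_vector_derivative, of A]
  show ?thesis by (simp add: o_def matrix_exp_commute)
qed

lemma matrix_exp_times_minus: "matrix_exp A t *v (matrix_exp A (- t) *v v) = v"
proof -
  have "((\<lambda>t. matrix_exp A t *v (matrix_exp A (- t) *v v)) has_vector_derivative 0) (at t within UNIV)" for t
  proof -
    have "((\<lambda>t. matrix_exp A (- t) *v v) has_vector_derivative - (A *v (matrix_exp A (- t) *v v))) (at t within UNIV)"
      using matrix_vector_has_vector_derivative[OF matrix_exp_minus_has_vector_derivative[of A t UNIV] has_vector_derivative_const[of v]]
      by (simp add: matrix_exp_commute matrix_vector_mul_assoc matrix_vector_mult_minus_left)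
    from matrix_vector_has_vector_derivative[OF matrix_exp_has_vector_derivative[of A t UNIV] this]
    show ?thesis
      by (simp add: matrix_vector_mult_minus_right matrix_vector_mul_assoc matrix_mul_assoc[symmetric] matrix_exp_commute[symmetric])
  qed
  then obtain c where "\<And>t. matrix_exp A t *v (matrix_exp A (- t) *v v) = c"
    by (rule has_vector_derivative_zero_constant[OF convex_UNIV]) auto
  from this[of t] this[of 0] show ?thesis by simp
qed

lemma state_trajectory_cong:
  assumes "\<And>t. t \<in> {0..1} \<Longrightarrow> u t = v t"
  shows "state_trajectory A B x0 u x \<longleftrightarrow> state_trajectory A B x0 v x"
  using assms unfolding state_trajectory_def by auto

lemma final_output_cong:
  assumes "\<And>t. t \<in> {0..1} \<Longrightarrow> u t = v t"
  shows "final_output A B C x0 u = final_output A B C x0 v"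
  using state_trajectory_cong[of u v A B x0, OF assms] unfolding final_output_def by simp

lemma state_trajectory_unique:
  assumes x: "state_trajectory A B x0 u x" and y: "state_trajectory A B x0 u y"
    and t: "t \<in> {0..1}"
  shows "x t = y t"
proof -
  define w where "w t = matrix_exp A (- t) *v (x t - y t)" for t
  have "(w has_vector_derivative 0) (at t within {0..1})" if t: "t \<in> {0..1}" for t
  proof -
    have "((\<lambda>t. x t - y t) has_vector_derivative A *v (x t - y t)) (at t within {0..1})"
      using x y t unfolding state_trajectory_def
      by (auto intro!: derivative_eq_intros simp: matrix_vector_mult_diff_distrib)
    from matrix_vector_has_vector_derivative[OF matrix_exp_minus_has_vector_derivative[of A t] this]
    show ?thesis
      unfolding w_def by (simp add: matrix_vector_mul_assoc matrix_vector_mult_minus_left)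
  qed
  then obtain c where c: "\<And>t. t \<in> {0..1} \<Longrightarrow> w t = c"
    by (rule has_vector_derivative_zero_constant[OF convex_real_interval(5)]) auto
  have "w t = w 0" using c[OF t] c[of 0] by simp
  also have "w 0 = 0" using x y by (simp add: w_def state_trajectory_def)
  finally have "x t - y t = 0"
    using matrix_exp_times_minus[of A t "x t - y t"] by (simp add: w_def)
  then show ?thesis by simp
qed

lemma final_output_eq:
  assumes x: "state_trajectory A B x0 u x"
  shows "final_output A B C x0 u = (C *v x 1) $ 1"
  unfolding final_output_def
proof (rule the_equality)
  show "\<exists>xa. state_trajectory A B x0 u xa \<and> (C *v x 1) $ 1 = (C *v xa 1) $ 1"
    using x by blast
next
  fix y1 assume "\<exists>xa. state_trajectory A B x0 u xa \<and> y1 = (C *v xa 1) $ 1"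
  then show "y1 = (C *v x 1) $ 1"
    using state_trajectory_unique[OF x, of _ 1] by force
qed

lemma continuous_on_matrix_exp: "continuous_on S (matrix_exp A)"
  using matrix_exp_has_vector_derivative
  by (meson continuous_on_eq_continuous_within has_vector_derivative_continuous)

lemma state_trajectory_variation_of_constants:
  assumes u: "continuous_on {0..1} u"
  shows "state_trajectory A B x0 u
    (\<lambda>t. matrix_exp A t *v (x0 + integral {0..t} (\<lambda>s. matrix_exp A (- s) *v (B *v u s))))"
  unfolding state_trajectory_def
proof (intro conjI ballI)
  fix t :: real assume t: "t \<in> {0..1}"
  let ?g = "\<lambda>s. matrix_exp A (- s) *v (B *v u s)"
  have "continuous_on {0..1} ?g"
    by (intro continuous_on_matrix_vector_mult continuous_on_compose2[OF continuous_on_matrix_exp]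
        continuous_intros u) auto
  from integral_has_vector_derivative[OF this t]
  have "((\<lambda>t. x0 + integral {0..t} ?g) has_vector_derivative ?g t) (at t within {0..1})"
    by (auto intro!: derivative_eq_intros)
  from matrix_vector_has_vector_derivative[OF matrix_exp_has_vector_derivative[of A t] this]
  show "((\<lambda>t. matrix_exp A t *v (x0 + integral {0..t} ?g)) has_vector_derivative
      A *v (matrix_exp A t *v (x0 + integral {0..t} ?g)) + B *v u t) (at t within {0..1})"
    by (simp add: matrix_exp_times_minus matrix_vector_mul_assoc[symmetric] add.commute)
qed auto

lemma final_output_variation_of_constants:
  assumes u: "continuous_on {0..1} u"
  shows "final_output A B C x0 u =
    (C *v (matrix_exp A 1 *v (x0 + integral {0..1} (\<lambda>s. matrix_exp A (- s) *v (B *v u s))))) $ 1"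
  by (rule final_output_eq[OF state_trajectory_variation_of_constants[OF u]])

text \<open>Multiplying the control by \<open>e\<^sup>\<delta>\<^sup>t\<close> shifts the exponents \<open>\<alpha>\<^sub>j\<close> by \<open>\<delta>\<close>; the final output depends continuously
  on \<open>\<delta>\<close>. This allows passing to controls that are not in resonance with \<open>A\<close>.\<close>

lemma final_output_exp_weight_tendsto:
  assumes u: "continuous_on {0..1} u"
  shows "((\<lambda>\<delta>. final_output A B C x0 (\<lambda>t. exp (\<delta> * t) *\<^sub>R u t)) \<longlongrightarrow> final_output A B C x0 u) (at 0)"
proof -
  define J where "J \<delta> = integral (cbox 0 1) (\<lambda>s. matrix_exp A (- s) *v (B *v (exp (\<delta> * s) *\<^sub>R u s)))" for \<delta> :: real
  have "continuous_on (UNIV \<times> cbox 0 1)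
      (\<lambda>(\<delta>::real, s::real). matrix_exp A (- s) *v (B *v (exp (\<delta> * s) *\<^sub>R u s)))"
    unfolding split_beta
    by (intro continuous_on_matrix_vector_mult continuous_on_compose2[OF continuous_on_matrix_exp]
        continuous_intros continuous_on_compose2[OF u]) auto
  then have J: "continuous_on UNIV J"
    unfolding J_def by (rule integral_continuous_on_param)
  have eq: "final_output A B C x0 (\<lambda>t. exp (\<delta> * t) *\<^sub>R u t) =
      (C *v (matrix_exp A 1 *v (x0 + J \<delta>))) $ 1" for \<delta>
    unfolding J_def using u
    by (subst final_output_variation_of_constants) (auto intro!: continuous_intros)
  have "continuous_on UNIV (\<lambda>\<delta>. final_output A B C x0 (\<lambda>t. exp (\<delta> * t) *\<^sub>R u t))"
    unfolding eq by (intro continuous_intros continuous_on_matrix_vector_mult J)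
  then have "isCont (\<lambda>\<delta>. final_output A B C x0 (\<lambda>t. exp (\<delta> * t) *\<^sub>R u t)) 0"
    by (simp add: continuous_on_eq_continuous_at)
  then show ?thesis by (simp add: isCont_def)
qed

section \<open>Explicit response to nonresonant inputs\<close>

text \<open>The adjugate matrix, with entries written as determinants in which one column is replaced by a unit
  vector. In this form they are visibly polynomial in the entries of \<open>M\<close>.\<close>

definition adjugate :: "'a::field ^ 'n ^ 'n \<Rightarrow> 'a ^ 'n ^ 'n" where
  "adjugate M = (\<chi> k j. det (\<chi> i h. if h = k then (if i = j then 1 else 0) else M $ i $ h))"

lemma matrix_vector_adjugate:
  fixes M :: "'a::field ^ 'n ^ 'n"
  assumes "det M \<noteq> 0"
  shows "M *v (adjugate M *v v) = det M *s v" "adjugate M *v (M *v v) = det M *s v"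
proof -
  define N where "N = (\<chi> k j. adjugate M $ k $ j / det M)"
  have "M *v column j N = axis j 1" for j
    unfolding cramer[OF assms] by (simp add: vec_eq_iff N_def column_def adjugate_def axis_def cong: if_cong)
  then have "(M ** N) $ i $ j = mat 1 $ i $ j" for i j
    by (auto simp: vec_eq_iff matrix_matrix_mult_def matrix_vector_mult_def column_def axis_def mat_def)
  then have MN: "M ** N = mat 1" by (simp add: vec_eq_iff)
  then have NM: "N ** M = mat 1" by (simp add: matrix_left_right_inverse)
  have adj: "adjugate M *v w = det M *s (N *v w)" for w
    using assms by (simp add: vec_eq_iff N_def matrix_vector_mult_def sum_distrib_left)
  show "M *v (adjugate M *v v) = det M *s v"
    using MN unfolding adj vector_scalar_commute[symmetric] by (simp add: matrix_vector_mul_assoc)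
  show "adjugate M *v (M *v v) = det M *s v"
    using NM unfolding adj by (simp add: matrix_vector_mul_assoc)
qed

text \<open>A real matrix regarded as a complex one.\<close>

definition complex_matrix :: "real ^ 'n ^ 'n \<Rightarrow> complex ^ 'n ^ 'n" where
  "complex_matrix A = (\<chi> i j. of_real (A $ i $ j))"

text \<open>The complex matrix \<open>A - \<mu>I\<close>.\<close>

definition shifted_matrix :: "real ^ 'n ^ 'n \<Rightarrow> complex \<Rightarrow> complex ^ 'n ^ 'n" where
  "shifted_matrix A \<mu> = (\<chi> i j. of_real (A $ i $ j) - (if i = j then \<mu> else 0))"

lemma shifted_matrix_mult: "shifted_matrix A \<mu> *v v = complex_matrix A *v v - \<mu> *s v"
  by (simp add: vec_eq_iff shifted_matrix_def complex_matrix_def matrix_vector_mult_def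
      left_diff_distrib sum_subtractf if_distrib[of "\<lambda>u. u * _"] cong: if_cong)

lemma adjugate_shifted_commute:
  assumes "det (shifted_matrix A \<mu>) \<noteq> 0"
  shows "adjugate (shifted_matrix A \<mu>) *v (complex_matrix A *v v) =
         complex_matrix A *v (adjugate (shifted_matrix A \<mu>) *v v)"
proof -
  let ?M = "shifted_matrix A \<mu>"
  have "adjugate ?M *v (?M *v v) = ?M *v (adjugate ?M *v v)"
    using matrix_vector_adjugate[OF assms] by simp
  then show ?thesis
    unfolding shifted_matrix_mult by (simp add: matrix_vector_mult_diff_distrib vector_scalar_commute)
qed

text \<open>The recursion behind the explicit particular solutions. If \<open>V' = AV + g b\<close> and \<open>\<phi>' = c g + \<mu> \<phi>\<close>, then
  \<open>W = adj(A - \<mu>I) (c V - \<phi> b)\<close> satisfies \<open>W' = AW + det(A - \<mu>I) \<phi> b\<close>.\<close>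

lemma adjugate_particular_solution_step:
  fixes A :: "real ^ 'n ^ 'n" and V :: "real \<Rightarrow> complex ^ 'n"
  assumes det: "det (shifted_matrix A \<mu>) \<noteq> 0"
    and V: "(V has_vector_derivative complex_matrix A *v V t + g *s b) (at t within S)"
    and \<phi>: "(\<phi> has_vector_derivative c * g + \<mu> * \<phi> t) (at t within S)"
  shows "((\<lambda>t. adjugate (shifted_matrix A \<mu>) *v (c *s V t - \<phi> t *s b)) has_vector_derivative
    complex_matrix A *v (adjugate (shifted_matrix A \<mu>) *v (c *s V t - \<phi> t *s b)) +
    (det (shifted_matrix A \<mu>) * \<phi> t) *s b) (at t within S)"
proof -
  let ?M = "shifted_matrix A \<mu>"
  have "((\<lambda>t. c *s V t - \<phi> t *s b) has_vector_derivative
      c *s (complex_matrix A *v V t + g *s b) - (c * g + \<mu> * \<phi> t) *s b) (at t within S)"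
  proof (rule has_vector_derivative_vec)
    fix i
    show "((\<lambda>t. (c *s V t - \<phi> t *s b) $ i) has_vector_derivative
      (c *s (complex_matrix A *v V t + g *s b) - (c * g + \<mu> * \<phi> t) *s b) $ i) (at t within S)"
      using has_vector_derivative_vec_nth[OF V, of i] \<phi>
      by (auto intro!: derivative_eq_intros simp: algebra_simps)
  qed
  from bounded_linear.has_vector_derivative[OF _ this, of "(*v) (adjugate ?M)"]
  have "((\<lambda>t. adjugate ?M *v (c *s V t - \<phi> t *s b)) has_vector_derivative
      adjugate ?M *v (c *s (complex_matrix A *v V t + g *s b) - (c * g + \<mu> * \<phi> t) *s b)) (at t within S)"
    by (simp add: linear_conv_bounded_linear[symmetric])
  also have "c *s (complex_matrix A *v V t + g *s b) - (c * g + \<mu> * \<phi> t) *s b =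
      complex_matrix A *v (c *s V t) - (\<mu> * \<phi> t) *s b"
    by (simp add: vector_scalar_commute vec_eq_iff algebra_simps)
  also have "adjugate ?M *v (complex_matrix A *v (c *s V t) - (\<mu> * \<phi> t) *s b) =
      complex_matrix A *v (adjugate ?M *v (c *s V t - \<phi> t *s b)) + (det ?M * \<phi> t) *s b"
  proof -
    have "(det ?M * \<phi> t) *s b = ?M *v (adjugate ?M *v (\<phi> t *s b))"
      by (simp add: matrix_vector_adjugate[OF det])
    also have "\<dots> = complex_matrix A *v (adjugate ?M *v (\<phi> t *s b)) - \<mu> *s (adjugate ?M *v (\<phi> t *s b))"
      by (rule shifted_matrix_mult)
    finally show ?thesis
      by (simp add: matrix_vector_mult_diff_distrib adjugate_shifted_commute[OF det] vector_scalar_commute)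
  qed
  finally show ?thesis .
qed

text \<open>For \<open>d = det(A - \<mu>I) \<noteq> 0\<close>, the quotient of this vector by \<open>d\<^sup>l\<^sup>+\<^sup>1\<close> is a particular solution of
  \<open>x' = Ax + t\<^sup>l e\<^sup>\<mu>\<^sup>t b\<close>. The vector itself is polynomial in the entries of \<open>A\<close> and \<open>b\<close>. The term \<open>0 *s 0\<close> makes
  the base case an instance of the same recursion.\<close>

primrec particular_numerator ::
    "real ^ 'n ^ 'n \<Rightarrow> complex \<Rightarrow> complex ^ 'n \<Rightarrow> nat \<Rightarrow> real \<Rightarrow> complex ^ 'n" where
  "particular_numerator A \<mu> b 0 t =
     adjugate (shifted_matrix A \<mu>) *v (0 *s 0 - exp (\<mu> * of_real t) *s b)"
| "particular_numerator A \<mu> b (Suc l) t =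
     adjugate (shifted_matrix A \<mu>) *v (of_nat (Suc l) *s particular_numerator A \<mu> b l t
       - ((det (shifted_matrix A \<mu>) * of_real t) ^ Suc l * exp (\<mu> * of_real t)) *s b)"

lemma particular_numerator_has_vector_derivative:
  assumes det: "det (shifted_matrix A \<mu>) \<noteq> 0"
  shows "(particular_numerator A \<mu> b l has_vector_derivative
     complex_matrix A *v particular_numerator A \<mu> b l t +
     (det (shifted_matrix A \<mu>) ^ Suc l * of_real t ^ l * exp (\<mu> * of_real t)) *s b) (at t within S)"
proof (induction l)
  case 0
  have "((\<lambda>_. 0) has_vector_derivative complex_matrix A *v 0 + 0 *s b) (at t within S)"
    by (simp add: has_vector_derivative_const)
  moreover have "((\<lambda>t. exp (\<mu> * of_real t)) has_vector_derivative 0 * 0 + \<mu> * exp (\<mu> * of_real t)) (at t within S)"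
    by (rule has_vector_derivative_real_field) (auto intro!: derivative_eq_intros)
  ultimately show ?case
    using adjugate_particular_solution_step[OF det, of "\<lambda>_. 0" t 0 b S "\<lambda>t. exp (\<mu> * of_real t)" 0]
    by simp
next
  case (Suc l)
  let ?d = "det (shifted_matrix A \<mu>)"
  have "((\<lambda>t. (?d * of_real t) ^ Suc l * exp (\<mu> * of_real t)) has_vector_derivative
      of_nat (Suc l) * (?d ^ Suc l * of_real t ^ l * exp (\<mu> * of_real t)) +
      \<mu> * ((?d * of_real t) ^ Suc l * exp (\<mu> * of_real t))) (at t within S)"
    by (rule has_vector_derivative_real_field)
       (rule derivative_eq_intros refl | simp add: power_mult_distrib algebra_simps)+
  from adjugate_particular_solution_step[OF det Suc this]
  show ?case by (simp add: power_mult_distrib mult_ac)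
qed

text \<open>The real function \<open>pr (t\<^sup>l e\<^sup>\<mu>\<^sup>t)\<close>, where \<open>pr\<close> is the real or the imaginary part: with \<open>\<mu> = \<alpha> + i\<beta>\<close> these are
  the cosine and the sine type basis inputs.\<close>

definition quasi_poly :: "(complex \<Rightarrow> real) \<Rightarrow> nat \<Rightarrow> complex \<Rightarrow> real \<Rightarrow> real" where
  "quasi_poly pr l \<mu> t = pr (of_real t ^ l * exp (\<mu> * of_real t))"

lemma quasi_poly_Re: "quasi_poly Re l (Complex a b) t = t ^ l * exp (a * t) * cos (b * t)"
  by (simp add: quasi_poly_def Re_exp flip: of_real_power)

lemma quasi_poly_Im: "quasi_poly Im l (Complex a b) t = t ^ l * exp (a * t) * sin (b * t)"
  by (simp add: quasi_poly_def Im_exp flip: of_real_power)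

text \<open>The real particular solution of \<open>x' = Ax + pr (t\<^sup>l e\<^sup>\<mu>\<^sup>t) b\<close>, valid when \<open>\<mu>\<close> is not an eigenvalue of \<open>A\<close>.\<close>

definition particular_solution ::
    "(complex \<Rightarrow> real) \<Rightarrow> nat \<Rightarrow> complex \<Rightarrow> real ^ 'n ^ 'n \<Rightarrow> real ^ 'n \<Rightarrow> real \<Rightarrow> real ^ 'n" where
  "particular_solution pr l \<mu> A b t =
     (\<chi> i. pr (particular_numerator A \<mu> (\<chi> i. of_real (b $ i)) l t $ i / det (shifted_matrix A \<mu>) ^ Suc l))"

lemma particular_solution_has_vector_derivative:
  assumes pr: "bounded_linear pr" and det: "det (shifted_matrix A \<mu>) \<noteq> 0"
  shows "(particular_solution pr l \<mu> A b has_vector_derivative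
     A *v particular_solution pr l \<mu> A b t + quasi_poly pr l \<mu> t *\<^sub>R b) (at t within S)"
proof (rule has_vector_derivative_vec)
  fix i
  let ?d = "det (shifted_matrix A \<mu>) ^ Suc l" and ?b = "(\<chi> i. of_real (b $ i)) :: complex ^ 'a"
  let ?T = "particular_numerator A \<mu> ?b l"
  have part_scale: "pr (of_real r * z) = r * pr z" for r z
    using linear_scale[OF bounded_linear.linear[OF pr], of r z] by (simp add: scaleR_conv_of_real)
  have "((\<lambda>t. pr (?T t $ i / ?d)) has_vector_derivative
      pr ((complex_matrix A *v ?T t + (?d * of_real t ^ l * exp (\<mu> * of_real t)) *s ?b) $ i / ?d)) (at t within S)"
    by (intro bounded_linear.has_vector_derivative[OF pr]
        bounded_linear.has_vector_derivative[OF bounded_linear_divide]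
        has_vector_derivative_vec_nth particular_numerator_has_vector_derivative[OF det])
  also have "(complex_matrix A *v ?T t + (?d * of_real t ^ l * exp (\<mu> * of_real t)) *s ?b) $ i / ?d =
      (\<Sum>j\<in>UNIV. of_real (A $ i $ j) * (?T t $ j / ?d)) + of_real (b $ i) * (of_real t ^ l * exp (\<mu> * of_real t))"
    using det by (simp add: complex_matrix_def matrix_vector_mult_def add_divide_distrib sum_divide_distrib del: power_Suc)
  also have "pr \<dots> = (A *v particular_solution pr l \<mu> A b t + quasi_poly pr l \<mu> t *\<^sub>R b) $ i"
    using bounded_linear.linear[OF pr]
    by (simp add: linear_add linear_sum part_scale matrix_vector_mult_def particular_solution_def quasi_poly_def
        mult.commute del: power_Suc times_divide_eq_right times_divide_eq_left)
  finally show "((\<lambda>t. particular_solution pr l \<mu> A b t $ i) has_vector_derivative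
      (A *v particular_solution pr l \<mu> A b t + quasi_poly pr l \<mu> t *\<^sub>R b) $ i) (at t within S)"
    by (simp add: particular_solution_def)
qed

text \<open>In the nonresonant case the final output is a closed expression in \<open>A\<close>, \<open>e\<^sup>A\<close>, \<open>B\<close>, \<open>C\<close> and \<open>x0\<close>, without
  integrals: a homogeneous solution plus one particular solution for each basis input.\<close>

lemma final_output_quasi_poly_input:
  fixes A :: "real ^ 'n ^ 'n" and B :: "real ^ 'm ^ 'n" and G :: "real ^ 'k ^ 'm"
  assumes pr: "\<And>j. bounded_linear (pr j)"
    and det: "\<And>j. det (shifted_matrix A (\<mu> j)) \<noteq> 0"
    and u: "\<And>t. t \<in> {0..1} \<Longrightarrow> u t = G *v (\<chi> j. quasi_poly (pr j) (l j) (\<mu> j) t)"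
  defines "s \<equiv> \<lambda>j. particular_solution (pr j) (l j) (\<mu> j) A (B *v column j G)"
  shows "final_output A B C x0 u =
    (C *v (matrix_exp A 1 *v (x0 - (\<Sum>j\<in>UNIV. s j 0)) + (\<Sum>j\<in>UNIV. s j 1))) $ 1"
proof -
  let ?x = "\<lambda>t. matrix_exp A t *v (x0 - (\<Sum>j\<in>UNIV. s j 0)) + (\<Sum>j\<in>UNIV. s j t)"
  have "state_trajectory A B x0 u ?x"
    unfolding state_trajectory_def
  proof (intro conjI ballI)
    fix t :: real assume t: "t \<in> {0..1}"
    have s: "(s j has_vector_derivative A *v s j t + quasi_poly (pr j) (l j) (\<mu> j) t *\<^sub>R (B *v column j G)) (at t within {0..1})" for j
      unfolding s_def by (rule particular_solution_has_vector_derivative[OF pr det])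
    have "B *v u t = (\<Sum>j\<in>UNIV. quasi_poly (pr j) (l j) (\<mu> j) t *\<^sub>R (B *v column j G))"
      unfolding u[OF t] by (subst matrix_mult_sum)
        (simp add: scalar_mult_eq_scaleR matrix_vector_mult_scaleR linear_sum[OF matrix_vector_mul_linear])
    then have "A *v ?x t + B *v u t = (A ** matrix_exp A t) *v (x0 - (\<Sum>j\<in>UNIV. s j 0)) + matrix_exp A t *v 0
        + (\<Sum>j\<in>UNIV. A *v s j t + quasi_poly (pr j) (l j) (\<mu> j) t *\<^sub>R (B *v column j G))"
      by (simp add: matrix_vector_right_distrib matrix_vector_mul_assoc linear_sum[OF matrix_vector_mul_linear] sum.distrib)
    moreover have "(?x has_vector_derivative \<dots>) (at t within {0..1})"
      using matrix_vector_has_vector_derivative[OF matrix_exp_has_vector_derivative[of A t "{0..1}"]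
          has_vector_derivative_const[of "x0 - (\<Sum>j\<in>UNIV. s j 0)"]] s
      by (auto intro!: derivative_eq_intros simp: add.commute)
    ultimately show "(?x has_vector_derivative A *v ?x t + B *v u t) (at t within {0..1})" by simp
  qed simp
  then show ?thesis by (rule final_output_eq)
qed

section \<open>Rational dependence of the final output on the system\<close>

lemma poly_fun_Re: "poly_fun d f \<Longrightarrow> poly_fun d (\<lambda>x. Re (f x))"
proof (induction rule: poly_fun.induct)
  case (coord d f i)
  then show ?case using poly_fun.coord[of d "\<lambda>x. Re (f x)" i] by simp
qed (auto intro: poly_fun.const poly_fun.add)

lemma poly_fun_Im: "poly_fun d f \<Longrightarrow> poly_fun d (\<lambda>x. Im (f x))"
proof (induction rule: poly_fun.induct)
  case (coord d f i)
  then show ?case using poly_fun.coord[of d "\<lambda>x. Im (f x)" i] by simp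
qed (auto intro: poly_fun.const poly_fun.add)

lemma poly_fun_cnj: "poly_fun d f \<Longrightarrow> poly_fun d (\<lambda>x. cnj (f x))"
proof (induction rule: poly_fun.induct)
  case (coord d f i)
  then show ?case using poly_fun.coord[of d "\<lambda>x. cnj (f x)" i] by simp
qed (auto intro: poly_fun.const poly_fun.add)

lemma poly_fun_of_real:
  "poly_fun d f \<Longrightarrow> poly_fun d (\<lambda>x. of_real (f x) :: 'b::real_normed_field)"
proof (induction rule: poly_fun.induct)
  case (coord d f i)
  then show ?case using poly_fun.coord[of d "\<lambda>x. of_real (f x) :: 'b" i] by simp
qed (auto intro: poly_fun.const poly_fun.add)

lemma poly_fun_det:
  fixes M :: "real ^ 'p \<Rightarrow> 'b::real_normed_field ^ 'n ^ 'n"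
  assumes "\<And>i j. poly_fun d (\<lambda>\<theta>. M \<theta> $ i $ j)"
  shows "poly_fun (d * CARD('n)) (\<lambda>\<theta>. det (M \<theta>))"
proof -
  have "poly_fun (\<Sum>i\<in>(UNIV :: 'n set). d) (\<lambda>\<theta>. \<Prod>i\<in>UNIV. M \<theta> $ i $ p i)" for p
    by (intro poly_fun_prod assms)
  then show ?thesis
    unfolding det_def by (intro poly_fun_sum poly_fun_scale) (simp add: mult.commute)
qed

lemma poly_fun_adjugate:
  fixes M :: "real ^ 'p \<Rightarrow> 'b::real_normed_field ^ 'n ^ 'n"
  assumes "\<And>i j. poly_fun d (\<lambda>\<theta>. M \<theta> $ i $ j)"
  shows "poly_fun (d * CARD('n)) (\<lambda>\<theta>. adjugate (M \<theta>) $ k $ j)"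
  unfolding adjugate_def vec_lambda_beta
proof (rule poly_fun_det)
  fix i h
  show "poly_fun d (\<lambda>\<theta>. (\<chi> i h. if h = k then if i = j then 1 else 0 else M \<theta> $ i $ h) $ i $ h)"
    by (cases "h = k") (auto intro: poly_fun.const assms)
qed

lemma poly_fun_shifted_matrix:
  assumes "\<And>i j. poly_fun 1 (\<lambda>\<theta>. A \<theta> $ i $ j)"
  shows "poly_fun 1 (\<lambda>\<theta>. shifted_matrix (A \<theta>) \<mu> $ i $ j)"
  unfolding shifted_matrix_def vec_lambda_beta
  by (intro poly_fun_diff poly_fun_of_real assms poly_fun.const)

lemma poly_fun_particular_numerator:
  fixes A :: "real ^ 'p \<Rightarrow> real ^ 'n ^ 'n"
  assumes A: "\<And>i j. poly_fun 1 (\<lambda>\<theta>. A \<theta> $ i $ j)" and b: "\<And>i. poly_fun 1 (\<lambda>\<theta>. b \<theta> $ i)"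
  shows "poly_fun (CARD('n) * Suc l + 1) (\<lambda>\<theta>. particular_numerator (A \<theta>) \<mu> (b \<theta>) l t $ i)"
proof (induction l arbitrary: i)
  case 0
  have "poly_fun (1 * CARD('n) + 1) (\<lambda>\<theta>. particular_numerator (A \<theta>) \<mu> (b \<theta>) 0 t $ i)"
    unfolding particular_numerator.simps matrix_vector_mult_def vec_lambda_beta vector_minus_component
      vector_smult_component
    by (intro poly_fun_sum poly_fun_mult poly_fun_adjugate poly_fun_shifted_matrix A poly_fun_diff
        poly_fun_scale b poly_fun.const)
  then show ?case by simp
next
  case (Suc l)
  have det: "poly_fun (1 * CARD('n) * Suc l) (\<lambda>\<theta>. det (shifted_matrix (A \<theta>) \<mu>) ^ Suc l)"
    by (intro poly_fun_power poly_fun_det poly_fun_shifted_matrix A)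
  have "poly_fun (CARD('n) * Suc l + 1)
      (\<lambda>\<theta>. of_real t ^ Suc l * exp (\<mu> * of_real t) * (det (shifted_matrix (A \<theta>) \<mu>) ^ Suc l * b \<theta> $ j))" for j
    by (intro poly_fun_scale poly_fun_mult'[OF det b]) simp
  then have "poly_fun (CARD('n) * Suc l + 1)
      (\<lambda>\<theta>. (det (shifted_matrix (A \<theta>) \<mu>) * of_real t) ^ Suc l * exp (\<mu> * of_real t) * b \<theta> $ j)" for j
    by (simp add: power_mult_distrib mult_ac)
  then have "poly_fun (CARD('n) * Suc l + 1)
      (\<lambda>\<theta>. of_nat (Suc l) * particular_numerator (A \<theta>) \<mu> (b \<theta>) l t $ j -
        (det (shifted_matrix (A \<theta>) \<mu>) * of_real t) ^ Suc l * exp (\<mu> * of_real t) * b \<theta> $ j)" for j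
    by (intro poly_fun_diff poly_fun_scale Suc)
  then have "poly_fun (1 * CARD('n) + (CARD('n) * Suc l + 1))
      (\<lambda>\<theta>. particular_numerator (A \<theta>) \<mu> (b \<theta>) (Suc l) t $ i)"
    unfolding particular_numerator.simps matrix_vector_mult_def vec_lambda_beta vector_minus_component
      vector_smult_component
    by (intro poly_fun_sum poly_fun_mult poly_fun_adjugate poly_fun_shifted_matrix A)
  then show ?case by (simp add: algebra_simps)
qed

text \<open>The common denominator is \<open>\<bar>det(A - \<mu>I)\<bar>\<^sup>2\<^sup>(\<^sup>l\<^sup>+\<^sup>1\<^sup>)\<close>: multiplying by the conjugate makes it real, so that real
  and imaginary parts of the numerator can be taken.\<close>

lemma particular_solution_rational:
  fixes A :: "real ^ 'p \<Rightarrow> real ^ 'n ^ 'n"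
  assumes A: "\<And>i j. poly_fun 1 (\<lambda>\<theta>. A \<theta> $ i $ j)" and b: "\<And>i. poly_fun 1 (\<lambda>\<theta>. b \<theta> $ i)"
    and pr: "pr = Re \<or> pr = Im"
  shows "\<exists>D N. poly_fun (2 * CARD('n) * Suc l) D \<and> (\<forall>t i. poly_fun (2 * CARD('n) * Suc l + 1) (N t i)) \<and>
    (\<forall>\<theta>. det (shifted_matrix (A \<theta>) \<mu>) \<noteq> 0 \<longrightarrow> D \<theta> \<noteq> 0 \<and>
       (\<forall>t i. N t i \<theta> = D \<theta> * particular_solution pr l \<mu> (A \<theta>) (b \<theta>) t $ i))"
proof -
  define d where "d \<theta> = det (shifted_matrix (A \<theta>) \<mu>)" for \<theta>
  define T where "T t i \<theta> = particular_numerator (A \<theta>) \<mu> (\<chi> i. of_real (b \<theta> $ i)) l t $ i" for t i \<theta>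
  define D where "D \<theta> = Re (d \<theta> ^ Suc l * cnj (d \<theta>) ^ Suc l)" for \<theta>
  define N where "N t i \<theta> = pr (T t i \<theta> * cnj (d \<theta>) ^ Suc l)" for t i \<theta>
  have d: "poly_fun (1 * CARD('n)) d"
    unfolding d_def by (intro poly_fun_det poly_fun_shifted_matrix A)
  have T: "poly_fun (CARD('n) * Suc l + 1) (T t i)" for t i
    unfolding T_def by (intro poly_fun_particular_numerator A) (unfold vec_lambda_beta, intro poly_fun_of_real b)
  have cd: "poly_fun (1 * CARD('n) * Suc l) (\<lambda>\<theta>. cnj (d \<theta>) ^ Suc l)"
    by (intro poly_fun_power poly_fun_cnj d)
  have "poly_fun (2 * CARD('n) * Suc l) D"
    unfolding D_def by (intro poly_fun_Re poly_fun_mult'[OF poly_fun_power[OF d] cd]) simp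
  moreover have "poly_fun (2 * CARD('n) * Suc l + 1) (N t i)" for t i
    using pr poly_fun_mult'[OF T[of t i] cd, of "2 * CARD('n) * Suc l + 1"]
    by (auto simp: N_def[abs_def] intro!: poly_fun_Re poly_fun_Im)
  moreover have "D \<theta> \<noteq> 0" "N t i \<theta> = D \<theta> * particular_solution pr l \<mu> (A \<theta>) (b \<theta>) t $ i"
    if "det (shifted_matrix (A \<theta>) \<mu>) \<noteq> 0" for \<theta> t i
  proof -
    have d0: "d \<theta> \<noteq> 0" using that by (simp add: d_def)
    have eq: "d \<theta> ^ Suc l * cnj (d \<theta>) ^ Suc l = of_real ((cmod (d \<theta>))\<^sup>2 ^ Suc l)"
      unfolding power_mult_distrib[symmetric] complex_norm_square[symmetric] by simp
    then have D: "D \<theta> = (cmod (d \<theta>))\<^sup>2 ^ Suc l" by (simp add: D_def del: power_Suc)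
    with d0 show "D \<theta> \<noteq> 0" by simp
    have "T t i \<theta> * cnj (d \<theta>) ^ Suc l = of_real (D \<theta>) * (T t i \<theta> / d \<theta> ^ Suc l)"
      using d0 by (simp only: D eq[symmetric]) (simp add: field_simps)
    moreover have "pr (of_real r * z) = r * pr z" for r z using pr by auto
    ultimately show "N t i \<theta> = D \<theta> * particular_solution pr l \<mu> (A \<theta>) (b \<theta>) t $ i"
      by (simp add: N_def particular_solution_def d_def T_def
          del: power_Suc times_divide_eq_right times_divide_eq_left)
  qed
  ultimately show ?thesis by (intro exI[of _ D] exI[of _ N]) blast
qed

text \<open>The final output as a quotient of polynomials of degree at most \<open>K\<close> in a parameter vector \<open>\<theta>\<close>, when the
  entries of the matrices are affine functions of \<open>\<theta>\<close>. The matrix \<open>E\<close> takes the place of \<open>e\<^sup>A\<close> and is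
  treated as independent of \<open>A\<close>. In \<open>K\<close>, the summand \<open>3\<close> accounts for the factors \<open>C\<close>, \<open>E\<close> and \<open>B\<close> (or \<open>x\<close>).\<close>

lemma output_rational:
  fixes A :: "real ^ 'p \<Rightarrow> real ^ 'n ^ 'n" and B :: "real ^ 'p \<Rightarrow> real ^ 'm ^ 'n"
    and C :: "real ^ 'p \<Rightarrow> real ^ 'n ^ 1" and G :: "real ^ 'k ^ 'm" and l :: "'k \<Rightarrow> nat"
    and \<mu> :: "'k \<Rightarrow> complex"
  assumes A: "\<And>i j. poly_fun 1 (\<lambda>\<theta>. A \<theta> $ i $ j)" and E: "\<And>i j. poly_fun 1 (\<lambda>\<theta>. E \<theta> $ i $ j)"
    and B: "\<And>i j. poly_fun 1 (\<lambda>\<theta>. B \<theta> $ i $ j)" and C: "\<And>i j. poly_fun 1 (\<lambda>\<theta>. C \<theta> $ i $ j)"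
    and x: "\<And>i. poly_fun 1 (\<lambda>\<theta>. x \<theta> $ i)"
    and pr: "\<And>j. pr j = Re \<or> pr j = Im"
    and K: "K = (\<Sum>j\<in>UNIV. 2 * CARD('n) * Suc (l j)) + 3"
  defines "s \<equiv> \<lambda>\<theta> j. particular_solution (pr j) (l j) (\<mu> j) (A \<theta>) (B \<theta> *v column j G)"
  shows "\<exists>Den Num. poly_fun K Den \<and> poly_fun K Num \<and>
    (\<forall>\<theta>. (\<forall>j. det (shifted_matrix (A \<theta>) (\<mu> j)) \<noteq> 0) \<longrightarrow> Den \<theta> \<noteq> 0 \<and>
      Num \<theta> = Den \<theta> * (C \<theta> *v (E \<theta> *v (x \<theta> - (\<Sum>j\<in>UNIV. s \<theta> j 0)) + (\<Sum>j\<in>UNIV. s \<theta> j 1))) $ 1)"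
proof -
  have "poly_fun 1 (\<lambda>\<theta>. (B \<theta> *v column j G) $ i)" for i j
  proof -
    have "poly_fun 1 (\<lambda>\<theta>. \<Sum>h\<in>UNIV. G $ h $ j * B \<theta> $ i $ h)"
      by (intro poly_fun_sum poly_fun_scale B)
    then show ?thesis by (simp add: matrix_vector_mult_def column_def mult.commute)
  qed
  from particular_solution_rational[OF A this pr]
  have "\<forall>j. \<exists>D N. poly_fun (2 * CARD('n) * Suc (l j)) D \<and> (\<forall>t i. poly_fun (2 * CARD('n) * Suc (l j) + 1) (N t i)) \<and>
    (\<forall>\<theta>. det (shifted_matrix (A \<theta>) (\<mu> j)) \<noteq> 0 \<longrightarrow> D \<theta> \<noteq> 0 \<and> (\<forall>t i. N t i \<theta> = D \<theta> * s \<theta> j t $ i))"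
    unfolding s_def by blast
  then obtain D N where D: "\<And>j. poly_fun (2 * CARD('n) * Suc (l j)) (D j)"
    and N: "\<And>j t i. poly_fun (2 * CARD('n) * Suc (l j) + 1) (N j t i)"
    and D0: "\<And>j \<theta>. det (shifted_matrix (A \<theta>) (\<mu> j)) \<noteq> 0 \<Longrightarrow> D j \<theta> \<noteq> 0"
    and DN: "\<And>j \<theta> t i. det (shifted_matrix (A \<theta>) (\<mu> j)) \<noteq> 0 \<Longrightarrow> N j t i \<theta> = D j \<theta> * s \<theta> j t $ i"
    unfolding choice_iff by blast
  define S where "S = (\<Sum>j\<in>(UNIV::'k set). 2 * CARD('n) * Suc (l j))"
  define Den where "Den \<theta> = (\<Prod>j\<in>UNIV. D j \<theta>)" for \<theta>
  define R where "R j t i \<theta> = (\<Prod>j'\<in>UNIV-{j}. D j' \<theta>) * N j t i \<theta>" for j t i \<theta>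
  define Num where "Num \<theta> = (\<Sum>i\<in>UNIV. C \<theta> $ 1 $ i *
     ((\<Sum>h\<in>UNIV. E \<theta> $ i $ h * (x \<theta> $ h * Den \<theta> - (\<Sum>j\<in>UNIV. R j 0 h \<theta>))) + (\<Sum>j\<in>UNIV. R j 1 i \<theta>)))" for \<theta>
  have Den: "poly_fun S Den"
    unfolding S_def Den_def by (intro poly_fun_prod D)
  have R: "poly_fun (S + 1) (R j t i)" for j t i
  proof -
    have "poly_fun ((\<Sum>j'\<in>UNIV-{j}. 2 * CARD('n) * Suc (l j')) + (2 * CARD('n) * Suc (l j) + 1)) (R j t i)"
      unfolding R_def by (intro poly_fun_mult poly_fun_prod D N)
    moreover have "S = 2 * CARD('n) * Suc (l j) + (\<Sum>j'\<in>UNIV-{j}. 2 * CARD('n) * Suc (l j'))"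
      unfolding S_def by (rule sum.remove) auto
    ultimately show ?thesis by (simp add: add_ac)
  qed
  have "poly_fun (S + 1) (\<lambda>\<theta>. x \<theta> $ h * Den \<theta> - (\<Sum>j\<in>UNIV. R j 0 h \<theta>))" for h
    by (intro poly_fun_diff poly_fun_mult'[OF x Den] poly_fun_sum R) simp
  then have "poly_fun (S + 2) (\<lambda>\<theta>. (\<Sum>h\<in>UNIV. E \<theta> $ i $ h * (x \<theta> $ h * Den \<theta> - (\<Sum>j\<in>UNIV. R j 0 h \<theta>))) + (\<Sum>j\<in>UNIV. R j 1 i \<theta>))" for i
    by (intro poly_fun.add poly_fun_sum poly_fun_mult'[OF E] poly_fun_mono[OF R]) auto
  then have "poly_fun K Num"
    unfolding Num_def K S_def[symmetric] by (intro poly_fun_sum poly_fun_mult'[OF C]) auto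
  moreover have "poly_fun K Den"
    using poly_fun_mono[OF Den] by (simp add: K S_def)
  moreover have "Den \<theta> \<noteq> 0 \<and>
      Num \<theta> = Den \<theta> * (C \<theta> *v (E \<theta> *v (x \<theta> - (\<Sum>j\<in>UNIV. s \<theta> j 0)) + (\<Sum>j\<in>UNIV. s \<theta> j 1))) $ 1"
    if nz: "\<forall>j. det (shifted_matrix (A \<theta>) (\<mu> j)) \<noteq> 0" for \<theta>
  proof
    show "Den \<theta> \<noteq> 0" using D0 nz by (simp add: Den_def)
    have Req: "R j t i \<theta> = Den \<theta> * s \<theta> j t $ i" for j t i
      unfolding R_def Den_def DN[OF nz[rule_format]] by (subst (2) prod.remove[of _ j]) (auto simp: mult_ac)
    show "Num \<theta> = Den \<theta> * (C \<theta> *v (E \<theta> *v (x \<theta> - (\<Sum>j\<in>UNIV. s \<theta> j 0)) + (\<Sum>j\<in>UNIV. s \<theta> j 1))) $ 1"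
      unfolding Num_def Req
      by (simp add: matrix_vector_mult_def sum_distrib_left algebra_simps sum_subtractf)
  qed
  ultimately show ?thesis by blast
qed

section \<open>Shattered sets and sign patterns\<close>

text \<open>A real matrix has finitely many complex eigenvalues.\<close>

lemma finite_shifted_matrix_singular: "finite {z. det (shifted_matrix A z) = 0}"
proof -
  define p :: "complex poly" where
    "p = det (\<chi> i j. [:of_real (A $ i $ j), if i = j then - 1 else 0:])"
  have p: "poly p z = det (shifted_matrix A z)" for z
    unfolding p_def det_def shifted_matrix_def
    by (simp add: poly_sum poly_prod) (intro sum.cong prod.cong arg_cong2[where f = "(*)"] refl; simp)
  \<comment> \<open>The polynomial is nonzero because eigenvalues are bounded by the sum of all absolute entries.\<close>
  define K where "K = (\<Sum>i\<in>UNIV. \<Sum>j\<in>UNIV. \<bar>A $ i $ j\<bar>)"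
  define z :: complex where "z = of_real (K + 1)"
  have K0: "K \<ge> 0" unfolding K_def by (intro sum_nonneg) auto
  have "det (shifted_matrix A z) \<noteq> 0"
  proof
    assume "det (shifted_matrix A z) = 0"
    then have "\<not> invertible (shifted_matrix A z)" by (simp add: invertible_det_nz)
    then obtain v where v: "v \<noteq> 0" "shifted_matrix A z *v v = 0"
      by (metis invertible_left_inverse matrix_left_invertible_ker)
    then have Av: "complex_matrix A *v v = z *s v" by (simp add: shifted_matrix_mult)
    have "Max (range (\<lambda>i. cmod (v $ i))) \<in> range (\<lambda>i. cmod (v $ i))"
      by (rule Max_in) auto
    then obtain i where "cmod (v $ i) = Max (range (\<lambda>i. cmod (v $ i)))" by fastforce
    then have i: "cmod (v $ j) \<le> cmod (v $ i)" for j
      by simp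
    have vi: "cmod (v $ i) > 0"
    proof (rule ccontr)
      assume "\<not> ?thesis"
      with i have "\<And>j. cmod (v $ j) \<le> 0" by (meson not_le order_trans)
      with v show False by (auto simp: vec_eq_iff)
    qed
    have "(K + 1) * cmod (v $ i) = cmod ((z *s v) $ i)"
    proof -
      have "cmod z = K + 1" using K0 unfolding z_def norm_of_real by simp
      then show ?thesis by (simp add: norm_mult)
    qed
    also have "\<dots> = cmod (\<Sum>j\<in>UNIV. of_real (A $ i $ j) * v $ j)"
      unfolding Av[symmetric] by (simp add: complex_matrix_def matrix_vector_mult_def)
    also have "\<dots> \<le> (\<Sum>j\<in>UNIV. \<bar>A $ i $ j\<bar> * cmod (v $ i))"
      by (intro order.trans[OF norm_sum] sum_mono) (auto simp: norm_mult intro!: mult_left_mono i)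
    also have "\<dots> \<le> K * cmod (v $ i)"
      unfolding K_def sum_distrib_right[symmetric]
      by (intro mult_right_mono member_le_sum[of i UNIV "\<lambda>i. \<Sum>j\<in>UNIV. \<bar>A $ i $ j\<bar>"]) (auto intro: sum_nonneg)
    finally show False using vi by (simp add: algebra_simps)
  qed
  then have "p \<noteq> 0" using p[of z] by auto
  from poly_roots_finite[OF this] show ?thesis by (simp add: p)
qed

lemma eventually_nonresonant:
  "\<forall>\<^sub>F \<delta> in at 0. det (shifted_matrix A (\<mu> + of_real \<delta>)) \<noteq> 0"
proof -
  let ?S = "{\<delta>::real. det (shifted_matrix A (\<mu> + of_real \<delta>)) = 0}"
  have "finite ((\<lambda>\<delta>::real. \<mu> + of_real \<delta>) -` {z. det (shifted_matrix A z) = 0})"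
    by (intro finite_vimageI finite_shifted_matrix_singular) (auto intro: injI)
  then have "finite ?S" by (simp add: vimage_def)
  then have "\<forall>\<^sub>F \<delta> in at 0. \<forall>s\<in>?S. \<delta> \<noteq> s"
    by (intro eventually_ball_finite) (auto intro: eventually_neq_at_within)
  then show ?thesis by eventually_elim auto
qed

lemma quasi_poly_shift:
  assumes "pr = Re \<or> pr = Im"
  shows "quasi_poly pr l (\<mu> + of_real \<delta>) t = exp (\<delta> * t) * quasi_poly pr l \<mu> t"
proof -
  have "pr (of_real r * z) = r * pr z" for r z using assms by auto
  then have "pr (of_real (exp (\<delta> * t)) * (of_real t ^ l * exp (\<mu> * of_real t))) =
      exp (\<delta> * t) * pr (of_real t ^ l * exp (\<mu> * of_real t))" .
  moreover have "of_real t ^ l * exp ((\<mu> + of_real \<delta>) * of_real t) =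
      of_real (exp (\<delta> * t)) * (of_real t ^ l * exp (\<mu> * of_real t))"
    unfolding distrib_right exp_add by (simp add: mult_ac flip: exp_of_real)
  ultimately show ?thesis by (simp only: quasi_poly_def)
qed

lemma continuous_on_quasi_poly:
  assumes "pr = Re \<or> pr = Im"
  shows "continuous_on S (quasi_poly pr l \<mu>)"
  using assms unfolding quasi_poly_def[abs_def] by (auto intro!: continuous_intros)

lemma finite_positive_margin:
  fixes f :: "'a \<Rightarrow> real"
  assumes "finite S"
  shows "\<exists>\<eta>>0. \<forall>s\<in>S. f s > 0 \<longrightarrow> f s > \<eta>"
  using assms
proof (induction S rule: finite_induct)
  case empty
  then show ?case by (intro exI[of _ 1]) auto
next
  case (insert s S)
  then obtain \<eta> where \<eta>: "\<eta> > 0" "\<forall>s\<in>S. f s > 0 \<longrightarrow> f s > \<eta>" by auto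
  show ?case
  proof (cases "f s > 0")
    case True
    then show ?thesis using \<eta> by (intro exI[of _ "min \<eta> (f s / 2)"]) auto
  next
    case False
    then show ?thesis using \<eta> by (intro exI[of _ \<eta>]) auto
  qed
qed

text \<open>Index type of the parameter vectors \<open>(A, e\<^sup>A, B, C, x\<^sup>0)\<close>.\<close>

type_synonym ('n, 'm) param = "'n \<times> 'n + 'n \<times> 'n + 'n \<times> 'm + 'n + 'n"

text \<open>The parameter vector of a system, \<open>E\<close> standing for \<open>e\<^sup>A\<close>.\<close>

definition pack_param ::
  "real ^ 'n ^ 'n \<Rightarrow> real ^ 'n ^ 'n \<Rightarrow> real ^ 'm ^ 'n \<Rightarrow> real ^ 'n ^ 1 \<Rightarrow> real ^ 'n \<Rightarrow> real ^ ('n, 'm) param" where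
  "pack_param A E B C x = (\<chi> p. case p of
      Inl (i, j) \<Rightarrow> A $ i $ j
    | Inr (Inl (i, j)) \<Rightarrow> E $ i $ j
    | Inr (Inr (Inl (i, j))) \<Rightarrow> B $ i $ j
    | Inr (Inr (Inr (Inl j))) \<Rightarrow> C $ 1 $ j
    | Inr (Inr (Inr (Inr i))) \<Rightarrow> x $ i)"

text \<open>Clearing the positive denominator makes the threshold condition quadratic in the output \<open>v\<close>.\<close>

lemma loss_threshold_iff:
  fixes v y \<rho> :: real
  shows "(v - y)\<^sup>2 / (1 + (v - y)\<^sup>2) - \<rho> > 0 \<longleftrightarrow> (1 - \<rho>) * (v - y)\<^sup>2 - \<rho> > 0"
proof -
  have "1 + (v - y)\<^sup>2 > 0" by (simp add: add_pos_nonneg)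
  then show ?thesis by (simp add: field_simps)
qed

text \<open>A shattered set \<open>D\<close> yields \<open>2 ^ card D\<close> parameter vectors with distinct strict sign patterns of \<open>card D\<close>
  polynomials of degree at most \<open>2K\<close>. Conditions \<open>\<psi> > 0\<close> and \<open>\<psi> \<le> 0\<close> are made strict by comparing with a
  margin \<open>\<eta>\<close>, and resonances are removed by shifting all exponents \<open>\<mu>\<^sub>j\<close> by one small \<open>\<delta>\<close>.\<close>

lemma shattered_set_bound:
  fixes l :: "'k::finite \<Rightarrow> nat" and D :: "((real \<Rightarrow> real ^ 'm::finite) \<times> real \<times> real) set"
  assumes basis: "basis_inputs l \<alpha> \<beta> \<omega>"
    and L: "\<And>z1 z2. L z1 z2 = (z1 - z2)\<^sup>2 / (1 + (z1 - z2)\<^sup>2)"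
    and D: "finite D" "D \<subseteq> input_space \<omega> \<times> UNIV \<times> UNIV"
    and sh: "shatters (loss_concept L ` system_class TYPE('n::finite)) D"
    and K: "K = (\<Sum>j\<in>UNIV. 2 * CARD('n) * Suc (l j)) + 3"
  shows "2 ^ card D \<le> 2 * (card D * (2 * K) + 1) ^ CARD(('n, 'm) param)"
proof -
  define \<mu> where "\<mu> j = Complex (\<alpha> j) (\<beta> j)" for j
  define pr where "pr j = (if \<forall>t\<in>{0..1}. \<omega> j t = t ^ l j * exp (\<alpha> j * t) * cos (\<beta> j * t) then Re else Im)" for j
  have pr: "pr j = Re \<or> pr j = Im" for j by (simp add: pr_def)
  have prl: "bounded_linear (pr j)" for j
    using pr[of j] bounded_linear_Re bounded_linear_Im by auto
  have \<omega>: "\<omega> j t = quasi_poly (pr j) (l j) (\<mu> j) t" if "t \<in> {0..1}" for j t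
  proof (cases "\<forall>t\<in>{0..1}. \<omega> j t = t ^ l j * exp (\<alpha> j * t) * cos (\<beta> j * t)")
    case True
    then have "pr j = Re" by (simp add: pr_def)
    with True that show ?thesis by (simp add: \<mu>_def quasi_poly_Re)
  next
    case False
    then have "pr j = Im" unfolding pr_def by (rule if_not_P)
    moreover have "\<forall>t\<in>{0..1}. \<omega> j t = t ^ l j * exp (\<alpha> j * t) * sin (\<beta> j * t)"
      using basis False unfolding basis_inputs_def by blast
    ultimately show ?thesis using that by (simp add: \<mu>_def quasi_poly_Im)
  qed
  define u where "u G \<delta> t = G *v (\<chi> j. quasi_poly (pr j) (l j) (\<mu> j + of_real \<delta>) t)"
    for G :: "real ^ 'k ^ 'm" and \<delta> t :: real
  have "\<forall>q\<in>D. \<exists>G. fst q = restrict (u G 0) {0..1}"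
  proof
    fix q assume "q \<in> D"
    then obtain G where "fst q = restrict (\<lambda>t. G *v (\<chi> j. \<omega> j t)) {0..1}"
      using D by (fastforce simp: input_space_def)
    then have "fst q = restrict (u G 0) {0..1}" by (auto simp: fun_eq_iff u_def \<omega> restrict_def)
    then show "\<exists>G. fst q = restrict (u G 0) {0..1}" ..
  qed
  from bchoice[OF this] obtain G where G: "\<And>q. q \<in> D \<Longrightarrow> fst q = restrict (u (G q) 0) {0..1}" by blast
  define y \<rho> where "y q = fst (snd q)" and "\<rho> q = snd (snd q)" for q :: "(real \<Rightarrow> real ^ 'm) \<times> real \<times> real"

  let ?F = "D \<rightarrow>\<^sub>E {0, 1::nat}"
  have finF: "finite ?F" using D by (intro finite_PiE) auto
  have "\<forall>g\<in>?F. \<exists>s::(real ^ 'n ^ 'n) \<times> (real ^ 'm ^ 'n) \<times> (real ^ 'n ^ 1) \<times> (real ^ 'n). restrict (loss_concept L (case s of (A, B, C, x) \<Rightarrow> final_output A B C x)) D = g"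
  proof
    fix g assume "g \<in> ?F"
    then obtain f where "f \<in> system_class TYPE('n)" "restrict (loss_concept L f) D = g"
      using sh unfolding shatters_def by blast
    then obtain A :: "real ^ 'n ^ 'n" and B C x where "restrict (loss_concept L (final_output A B C x)) D = g"
      unfolding system_class_def by blast
    then show "\<exists>s::(real ^ 'n ^ 'n) \<times> (real ^ 'm ^ 'n) \<times> (real ^ 'n ^ 1) \<times> (real ^ 'n).
        restrict (loss_concept L (case s of (A, B, C, x) \<Rightarrow> final_output A B C x)) D = g"
      by (intro exI[of _ "(A, B, C, x)"]) simp
  qed
  from bchoice[OF this] obtain s :: "((real \<Rightarrow> real ^ 'm) \<times> real \<times> real \<Rightarrow> nat) \<Rightarrow>
      (real ^ 'n ^ 'n) \<times> (real ^ 'm ^ 'n) \<times> (real ^ 'n ^ 1) \<times> (real ^ 'n)"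
    where s: "\<And>g. g \<in> ?F \<Longrightarrow> restrict (loss_concept L (case s g of (A, B, C, x) \<Rightarrow> final_output A B C x)) D = g"
    by blast
  define A B C x where "A g = fst (s g)" and "B g = fst (snd (s g))" and "C g = fst (snd (snd (s g)))"
    and "x g = snd (snd (snd (s g)))" for g
  define \<Phi> where "\<Phi> g q \<delta> = final_output (A g) (B g) (C g) (x g) (u (G q) \<delta>)" for g q \<delta>
  define \<psi> where "\<psi> g q \<delta> = (1 - \<rho> q) * (\<Phi> g q \<delta> - y q)\<^sup>2 - \<rho> q" for g q \<delta>
  have gq: "g q = 1 \<longleftrightarrow> \<psi> g q 0 > 0" if g: "g \<in> ?F" and q: "q \<in> D" for g q
  proof -
    have "g q = loss_concept L (final_output (A g) (B g) (C g) (x g)) q"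
      using fun_cong[OF s[OF g], of q] q by (simp add: A_def B_def C_def x_def case_prod_beta)
    also have "\<dots> = sign01 (L (final_output (A g) (B g) (C g) (x g) (fst q)) (y q) - \<rho> q)"
      by (cases q) (simp add: loss_concept_def y_def \<rho>_def)
    also have "final_output (A g) (B g) (C g) (x g) (fst q) = \<Phi> g q 0"
      unfolding \<Phi>_def G[OF q] by (intro final_output_cong) simp
    finally show ?thesis
      unfolding L \<psi>_def sign01_def loss_threshold_iff by simp
  qed
  have \<Phi>_lim: "((\<Phi> g q) \<longlongrightarrow> \<Phi> g q 0) (at 0)" for g q
  proof -
    have "continuous_on {0..1} (u (G q) 0)"
      unfolding u_def[abs_def] by (intro continuous_on_matrix_vector_mult continuous_intros continuous_on_quasi_poly pr)
    from final_output_exp_weight_tendsto[OF this, of "A g" "B g" "C g" "x g"]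
    have "((\<lambda>\<delta>. final_output (A g) (B g) (C g) (x g) (\<lambda>t. exp (\<delta> * t) *\<^sub>R u (G q) 0 t)) \<longlongrightarrow> \<Phi> g q 0) (at 0)"
      by (simp add: \<Phi>_def)
    moreover have "(\<lambda>t. exp (\<delta> * t) *\<^sub>R u (G q) 0 t) = u (G q) \<delta>" for \<delta>
      by (rule ext) (simp add: u_def quasi_poly_shift[OF pr] matrix_vector_mult_scaleR[symmetric] vec_eq_iff
          matrix_vector_mult_def sum_distrib_left mult_ac)
    ultimately show ?thesis by (simp add: \<Phi>_def[abs_def])
  qed
  \<comment> \<open>Only finitely many systems and data points matter, so the positive values of \<open>\<psi>\<close> exceed some \<open>\<eta> > 0\<close>.\<close>
  obtain \<eta> where \<eta>_pos: "\<eta> > 0"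
    and margin: "\<forall>p\<in>?F \<times> D. \<psi> (fst p) (snd p) 0 > 0 \<longrightarrow> \<psi> (fst p) (snd p) 0 > \<eta>"
    using finite_positive_margin[OF finite_cartesian_product[OF finF D(1)],
        of "\<lambda>p. \<psi> (fst p) (snd p) 0"] by blast
  have \<eta>: "\<psi> g q 0 > \<eta>" if "g \<in> ?F" "q \<in> D" "\<psi> g q 0 > 0" for g q
    using bspec[OF margin, of "(g, q)"] that unfolding fst_conv snd_conv by blast
  have ev1: "\<forall>\<^sub>F \<delta> in at 0. \<psi> g q \<delta> \<noteq> \<eta> \<and> (\<psi> g q \<delta> > \<eta> \<longleftrightarrow> g q = 1)" if g: "g \<in> ?F" and q: "q \<in> D" for g q
  proof -
    have lim: "((\<psi> g q) \<longlongrightarrow> \<psi> g q 0) (at 0)"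
      unfolding \<psi>_def[abs_def] by (intro tendsto_intros \<Phi>_lim)
    show ?thesis
    proof (cases "g q = 1")
      case True
      then have "\<psi> g q 0 > \<eta>" using gq[OF g q] \<eta>[OF g q] by simp
      from order_tendstoD(1)[OF lim this] show ?thesis by eventually_elim (use True in auto)
    next
      case False
      then have "\<psi> g q 0 < \<eta>" using gq[OF g q] \<eta>_pos by simp
      from order_tendstoD(2)[OF lim this] show ?thesis by eventually_elim (use False in auto)
    qed
  qed
  have "\<forall>\<^sub>F \<delta> in at 0. (\<forall>g\<in>?F. \<forall>q\<in>D. \<psi> g q \<delta> \<noteq> \<eta> \<and> (\<psi> g q \<delta> > \<eta> \<longleftrightarrow> g q = 1)) \<and>
      (\<forall>g\<in>?F. \<forall>j\<in>UNIV. det (shifted_matrix (A g) (\<mu> j + of_real \<delta>)) \<noteq> 0)"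
    using finF D(1) by (intro eventually_conj eventually_ball_finite ballI ev1 eventually_nonresonant) auto
  from eventually_happens'[OF at_neq_bot this] obtain \<delta> where
    good: "(\<forall>g\<in>?F. \<forall>q\<in>D. \<psi> g q \<delta> \<noteq> \<eta> \<and> (\<psi> g q \<delta> > \<eta> \<longleftrightarrow> g q = 1)) \<and>
      (\<forall>g\<in>?F. \<forall>j\<in>UNIV. det (shifted_matrix (A g) (\<mu> j + of_real \<delta>)) \<noteq> 0)" ..
  have \<delta>: "\<psi> g q \<delta> \<noteq> \<eta> \<and> (\<psi> g q \<delta> > \<eta> \<longleftrightarrow> g q = 1)" if "g \<in> ?F" "q \<in> D" for g q
    using bspec[OF bspec[OF conjunct1[OF good] that(1)] that(2)] .
  have nonres: "det (shifted_matrix (A g) (\<mu> j + of_real \<delta>)) \<noteq> 0" if "g \<in> ?F" for g j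
    using bspec[OF bspec[OF conjunct2[OF good] that] UNIV_I] .

  define pA pE :: "real ^ ('n, 'm) param \<Rightarrow> real ^ 'n ^ 'n"
    where "pA \<theta> = (\<chi> i j. \<theta> $ Inl (i, j))" and "pE \<theta> = (\<chi> i j. \<theta> $ Inr (Inl (i, j)))" for \<theta>
  define pB :: "real ^ ('n, 'm) param \<Rightarrow> real ^ 'm ^ 'n"
    where "pB \<theta> = (\<chi> i j. \<theta> $ Inr (Inr (Inl (i, j))))" for \<theta>
  define pC :: "real ^ ('n, 'm) param \<Rightarrow> real ^ 'n ^ 1"
    where "pC \<theta> = (\<chi> i j. \<theta> $ Inr (Inr (Inr (Inl j))))" for \<theta>
  define px :: "real ^ ('n, 'm) param \<Rightarrow> real ^ 'n"
    where "px \<theta> = (\<chi> i. \<theta> $ Inr (Inr (Inr (Inr i))))" for \<theta>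
  define \<theta> where "\<theta> g = pack_param (A g) (matrix_exp (A g) 1) (B g) (C g) (x g)" for g
  have p\<theta>: "pA (\<theta> g) = A g" "pE (\<theta> g) = matrix_exp (A g) 1" "pB (\<theta> g) = B g" "pC (\<theta> g) = C g" "px (\<theta> g) = x g" for g
    by (auto simp: \<theta>_def pack_param_def pA_def pE_def pB_def pC_def px_def vec_eq_iff num1_eq1)
  define sol where "sol q \<theta> j = particular_solution (pr j) (l j) (\<mu> j + of_real \<delta>) (pA \<theta>) (pB \<theta> *v column j (G q))"
    for q \<theta> j
  have "\<forall>q. \<exists>Den Num. poly_fun K Den \<and> poly_fun K Num \<and>
    (\<forall>\<theta>. (\<forall>j. det (shifted_matrix (pA \<theta>) (\<mu> j + of_real \<delta>)) \<noteq> 0) \<longrightarrow> Den \<theta> \<noteq> 0 \<and>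
      Num \<theta> = Den \<theta> * (pC \<theta> *v (pE \<theta> *v (px \<theta> - (\<Sum>j\<in>UNIV. sol q \<theta> j 0)) + (\<Sum>j\<in>UNIV. sol q \<theta> j 1))) $ 1)"
    unfolding sol_def
    by (rule allI, rule output_rational[OF _ _ _ _ _ pr K])
       (simp_all add: pA_def pE_def pB_def pC_def px_def poly_fun_real_coord1)
  then obtain Den Num where Den: "\<And>q. poly_fun K (Den q)" and Num: "\<And>q. poly_fun K (Num q)"
    and DN: "\<And>q \<theta>. (\<forall>j. det (shifted_matrix (pA \<theta>) (\<mu> j + of_real \<delta>)) \<noteq> 0) \<Longrightarrow> Den q \<theta> \<noteq> 0 \<and>
      Num q \<theta> = Den q \<theta> * (pC \<theta> *v (pE \<theta> *v (px \<theta> - (\<Sum>j\<in>UNIV. sol q \<theta> j 0)) + (\<Sum>j\<in>UNIV. sol q \<theta> j 1))) $ 1"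
    unfolding choice_iff by blast
  \<comment> \<open>The threshold condition \<open>\<psi> > \<eta>\<close> multiplied by the square of the denominator.\<close>
  define P where "P q \<theta> = (1 - \<rho> q) * (Num q \<theta> - y q * Den q \<theta>)\<^sup>2 - (\<rho> q + \<eta>) * (Den q \<theta>)\<^sup>2" for q \<theta>
  have P: "poly_fun (2 * K) (P q)" for q
  proof -
    have "poly_fun (K * 2) (P q)"
      unfolding P_def by (intro poly_fun_diff poly_fun_scale poly_fun_power Den Num)
    then show ?thesis by (simp add: mult.commute)
  qed
  have P\<theta>: "P q (\<theta> g) = (Den q (\<theta> g))\<^sup>2 * (\<psi> g q \<delta> - \<eta>)" "Den q (\<theta> g) \<noteq> 0" if g: "g \<in> ?F" for g q
  proof -
    have *: "Den q (\<theta> g) \<noteq> 0" "Num q (\<theta> g) = Den q (\<theta> g) * (C g *v (matrix_exp (A g) 1 *v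
      (x g - (\<Sum>j\<in>UNIV. sol q (\<theta> g) j 0)) + (\<Sum>j\<in>UNIV. sol q (\<theta> g) j 1))) $ 1"
      using DN[of "\<theta> g" q] nonres[OF g] by (auto simp: p\<theta>)
    show "Den q (\<theta> g) \<noteq> 0" by fact
    have "\<Phi> g q \<delta> = (C g *v (matrix_exp (A g) 1 *v
      (x g - (\<Sum>j\<in>UNIV. sol q (\<theta> g) j 0)) + (\<Sum>j\<in>UNIV. sol q (\<theta> g) j 1))) $ 1"
      unfolding \<Phi>_def sol_def p\<theta>
      by (rule final_output_quasi_poly_input[OF prl nonres[OF g]]) (simp add: u_def)
    with * have "Num q (\<theta> g) = Den q (\<theta> g) * \<Phi> g q \<delta>" by simp
    then show "P q (\<theta> g) = (Den q (\<theta> g))\<^sup>2 * (\<psi> g q \<delta> - \<eta>)"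
      by (simp add: P_def \<psi>_def power2_eq_square algebra_simps)
  qed
  have sgn: "P q (\<theta> g) \<noteq> 0" "P q (\<theta> g) > 0 \<longleftrightarrow> g q = 1" if "g \<in> ?F" "q \<in> D" for g q
    using P\<theta>[OF that(1), of q] \<delta>[OF that] by (auto simp: zero_less_mult_iff)
  have pattern_inj: "g = h" if g: "g \<in> ?F" and h: "h \<in> ?F"
    and eq: "{q \<in> D. P q (\<theta> g) > 0} = {q \<in> D. P q (\<theta> h) > 0}" for g h
  proof (rule PiE_ext[OF g h])
    fix q assume q: "q \<in> D"
    have "P q (\<theta> g) > 0 \<longleftrightarrow> P q (\<theta> h) > 0" using eq q by blast
    then have "g q = 1 \<longleftrightarrow> h q = 1" using sgn(2) g h q by simp
    moreover have "g q \<in> {0, 1}" "h q \<in> {0, 1}" using g h q by (auto simp: PiE_iff)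
    ultimately show "g q = h q" by auto
  qed
  have "inj_on \<theta> ?F" by (rule inj_onI) (rule pattern_inj, auto)
  then have "card (\<theta> ` ?F) = 2 ^ card D"
    using D(1) by (simp add: card_image card_PiE numeral_2_eq_2)
  moreover have "card (\<theta> ` ?F) \<le> 2 * (card D * (2 * K) + 1) ^ CARD(('n, 'm) param)"
  proof (rule card_sign_patterns_le[OF D(1) P])
    show "inj_on (\<lambda>x. {i \<in> D. P i x > 0}) (\<theta> ` ?F)"
    proof (rule inj_onI)
      fix a b assume "a \<in> \<theta> ` ?F" "b \<in> \<theta> ` ?F" and eq: "{i \<in> D. P i a > 0} = {i \<in> D. P i b > 0}"
      then obtain g h where gh: "g \<in> ?F" "h \<in> ?F" "a = \<theta> g" "b = \<theta> h" by (elim imageE)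
      with eq have "g = h" by (intro pattern_inj) auto
      with gh show "a = b" by simp
    qed
    show "finite (\<theta> ` ?F)" using finF by simp
    show "P i a \<noteq> 0" if a: "a \<in> \<theta> ` ?F" and i: "i \<in> D" for a i
    proof -
      obtain g where "g \<in> ?F" "a = \<theta> g" using a by (elim imageE)
      with sgn(1) i show ?thesis by simp
    qed
    show "odd (card D * (2 * K) + 1)" by simp
    show "card D * (2 * K) \<le> card D * (2 * K) + 1" by simp
  qed
  ultimately show ?thesis by (simp only:)
qed

section \<open>Numerical estimates\<close>

lemma log2_le_half_add_1:
  assumes "w > 0"
  shows "log 2 w \<le> w / 2 + 1"
proof -
  have "ln (w / 2 / 2) \<le> w / 2 / 2 - 1" using assms by (intro ln_le_minus_one) auto
  then have "ln (w / 2) \<le> w / 2 / 2 - 1 + ln 2" using assms by (subst (asm) ln_div) auto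
  also have "\<dots> \<le> (w / 2) * (1 / 2)" using ln_2_less_1 by simp
  also have "\<dots> \<le> (w / 2) * ln 2"
    using assms ln2_ge_two_thirds by (intro mult_left_mono) auto
  finally have "log 2 (w / 2) \<le> w / 2" by (simp add: log_def field_simps)
  then show ?thesis using assms by (simp add: log_divide)
qed

text \<open>Solving \<open>2\<^sup>V \<le> 2 (V d + 1)\<^sup>p\<close> for \<open>V\<close>. With \<open>w = V / N\<close> the inequality gives \<open>w \<le> log\<^sub>2 (2 d N) + log\<^sub>2 w\<close>, and
  \<open>log\<^sub>2 w\<close> is absorbed by \<open>log\<^sub>2 w \<le> w / 2 + 1\<close>.\<close>

lemma le_log_of_exp_le_poly:
  fixes V d p :: nat and N :: real
  assumes V: "V \<ge> 1" and d: "d \<ge> 1" and le: "2 ^ V \<le> 2 * (V * d + 1) ^ p" and N: "real p + 1 \<le> N"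
  shows "real V \<le> 2 * N * log 2 (4 * real d * N)"
proof -
  define z where "z = real V * real d"
  have z: "z \<ge> 1" unfolding z_def using mult_mono[of 1 "real V" 1 "real d"] V d by simp
  have N1: "N \<ge> 1" using N by linarith
  have "2 ^ V \<le> 2 * (z + 1) ^ p"
  proof -
    have "real (2 ^ V) \<le> real (2 * (V * d + 1) ^ p)" using le by (rule of_nat_mono)
    then show ?thesis by (simp add: z_def add.commute)
  qed
  also have "\<dots> \<le> (2 * z) * (2 * z) ^ p"
    using z by (intro mult_mono power_mono) auto
  also have "\<dots> = (2 * z) powr (real p + 1)"
    using z by (simp add: powr_add powr_realpow)
  also have "\<dots> \<le> (2 * z) powr N" using z N by (intro powr_mono) auto
  finally have "2 powr real V \<le> (2 * z) powr N" by (simp add: powr_realpow)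
  then have "log 2 (2 powr real V) \<le> log 2 ((2 * z) powr N)"
    using z by (subst log_le_cancel_iff) auto
  then have VN: "real V \<le> N * log 2 (2 * z)" using z by (simp add: log_powr)
  define w where "w = real V / N"
  have w: "w > 0" using V N1 by (simp add: w_def)
  have dN: "2 * real d * N > 0" using d N1 by simp
  have "2 * z = (2 * real d * N) * w" using N1 by (simp add: w_def z_def)
  then have "log 2 (2 * z) = log 2 (2 * real d * N) + log 2 w"
    using w dN by (simp only: log_mult_pos)
  also have "\<dots> \<le> log 2 (2 * real d * N) + (w / 2 + 1)"
    using log2_le_half_add_1[OF w] by simp
  finally have "N * log 2 (2 * z) \<le> N * (log 2 (2 * real d * N) + (w / 2 + 1))"
    using N1 by (intro mult_left_mono) auto
  also have "\<dots> = N * (log 2 (2 * real d * N) + 1) + real V / 2"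
    using N1 by (simp add: w_def field_simps)
  finally have "real V / 2 \<le> N * (log 2 (2 * real d * N) + 1)" using VN by simp
  also have "log 2 (2 * real d * N) + 1 = log 2 (2 * (2 * real d * N))"
    using dN log_mult_pos[of 2 "2 * real d * N" 2] by simp
  finally show ?thesis by (simp add: algebra_simps)
qed

text \<open>The argument of the logarithm produced by the sign count is at most the claimed one; the power
  \<open>(2k + 1)\<^sup>n\<close> is bounded below by Bernoulli's inequality.\<close>

lemma degree_times_dimension_bound:
  fixes n m k l d :: nat
  assumes n: "n \<ge> 1" and m: "m \<ge> 1" and k: "k \<ge> 1"
    and d: "d \<le> 4 * n * k * (l + 1) + 6"
  shows "4 * real d * (2 * real m * real n ^ 2 + 4 * real n + 1) \<le>
    16 * exp 1 * (8 * real m * real n ^ 2 * real k * (real n + real l) + 1) *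
               (2 * real n * real k + 2 * (2 * real k + 1) ^ n)"
proof -
  define q where "q = real n * real k * (real n + real l)"
  have r: "real n \<ge> 1" "real m \<ge> 1" "real k \<ge> 1" using n m k by auto
  have nk: "real n * real k \<ge> 1" using mult_mono[of 1 "real n" 1 "real k"] r by simp
  have q1: "real n * real k * (real l + 1) \<le> q" unfolding q_def using r by (intro mult_left_mono) auto
  have "1 * 1 \<le> real n * real k * (real l + 1)" using nk by (intro mult_mono) auto
  with q1 have q: "q \<ge> 1" by linarith
  have "real d \<le> 4 * (real n * real k * (real l + 1)) + 6"
    using of_nat_mono[OF d, where 'a=real] by (simp add: algebra_simps)
  with q1 q have d': "real d \<le> 10 * q" by linarith
  define M where "M = real m * real n ^ 2"
  have "1 * real n \<le> real m * (real n * real n)"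
    using r by (intro mult_mono mult_right_mono) (auto simp: mult_le_cancel_left1)
  then have nM: "real n \<le> M" by (simp add: M_def power2_eq_square)
  with r have M: "M \<ge> 1" by linarith
  have s: "1 + real n * (2 * real k) \<le> (2 * real k + 1) ^ n"
    using Bernoulli_inequality[of "2 * real k" n] by (simp add: add.commute)
  have s': "6 * (real n * real k) \<le> 2 * real n * real k + 2 * (2 * real k + 1) ^ n"
    using s by (simp add: algebra_simps)
  have "4 * real d * (2 * real m * real n ^ 2 + 4 * real n + 1) \<le> 4 * (10 * q) * (7 * M)"
    using d' nM M q r by (intro mult_mono) (auto simp: M_def)
  also have "\<dots> \<le> 16 * 8 * 6 * (M * q) * 1"
    using M q by simp
  also have "\<dots> \<le> 16 * 8 * 6 * (M * q) * real k"
    using M q r by (intro mult_left_mono) auto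
  also have "\<dots> = 16 * 1 * (8 * real m * real n ^ 2 * real k * (real n + real l)) * (6 * (real n * real k))"
    by (simp add: M_def q_def mult_ac)
  also have "\<dots> \<le> 16 * exp 1 * (8 * real m * real n ^ 2 * real k * (real n + real l) + 1) *
      (2 * real n * real k + 2 * (2 * real k + 1) ^ n)"
    using s' by (intro mult_mono) auto
  finally show ?thesis .
qed

lemma card_param:
  "CARD(('n::finite, 'm::finite) param) = 2 * CARD('n)\<^sup>2 + CARD('n) * CARD('m) + 2 * CARD('n)"
  by (simp add: card_sum card_prod power2_eq_square)

lemma param_count_bound:
  fixes n m :: nat
  assumes "n \<ge> 1" "m \<ge> 1"
  shows "real (2 * n\<^sup>2 + n * m + 2 * n) + 1 \<le> 2 * real m * real n ^ 2 + 4 * real n + 1"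
proof -
  obtain m' where m: "m = Suc m'" using assms by (cases m) auto
  have le: "m' * n \<le> m' * (n * (n * 2))" using assms by (intro mult_left_mono) auto
  have "2 * n\<^sup>2 + n * m + 2 * n + 1 \<le> 2 * m * n ^ 2 + 4 * n + 1"
    by (simp add: m power2_eq_square algebra_simps) (use le in linarith)
  from of_nat_mono[OF this, where 'a=real] show ?thesis by simp
qed

section \<open>The bound on the pseudo-dimension\<close>

theorem theorem3p4:
  fixes l :: "'k::finite \<Rightarrow> nat" and \<alpha> \<beta> :: "'k \<Rightarrow> real"
    and \<omega> :: "'k \<Rightarrow> real \<Rightarrow> real"
    and L :: "real \<Rightarrow> real \<Rightarrow> real"
    and n m k lmax :: nat
  assumes "n = CARD('n::finite)" and "m = CARD('m::finite)" and "k = CARD('k)"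
    and "basis_inputs l \<alpha> \<beta> \<omega>"
    and "lmax = Max (range l)"
    and "\<And>z1 z2. L z1 z2 = (z1 - z2)\<^sup>2 / (1 + (z1 - z2)\<^sup>2)"
  shows "ereal_of_enat
      (pseudo_dim (input_space \<omega> :: (real \<Rightarrow> real ^ 'm) set) UNIV (system_class TYPE('n)) L)
    \<le> ereal (2 * (2 * real m * real n ^ 2 + 4 * real n + 1) *
        log 2 (16 * exp 1 * (8 * real m * real n ^ 2 * real k * (real n + real lmax) + 1) *
               (2 * real n * real k + 2 * (2 * real k + 1) ^ n)))"
proof -
  define N where "N = 2 * real m * real n ^ 2 + 4 * real n + 1"
  define X where "X = 16 * exp 1 * (8 * real m * real n ^ 2 * real k * (real n + real lmax) + 1) *
               (2 * real n * real k + 2 * (2 * real k + 1) ^ n)"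
  define K where "K = (\<Sum>j\<in>UNIV. 2 * CARD('n) * Suc (l j)) + 3"
  have nmk: "n \<ge> 1" "m \<ge> 1" "k \<ge> 1" using assms(1-3) by (simp_all add: Suc_leI)
  have N1: "N \<ge> 1" by (simp add: N_def)
  have "(\<Sum>j\<in>UNIV. 2 * CARD('n) * Suc (l j)) \<le> (\<Sum>j\<in>(UNIV :: 'k set). 2 * n * (lmax + 1))"
    unfolding assms(1,5) by (intro sum_mono mult_left_mono) auto
  also have "\<dots> = 2 * n * k * (lmax + 1)" by (simp add: assms(3) algebra_simps)
  finally have "K \<le> 2 * n * k * (lmax + 1) + 3" unfolding K_def by (rule add_right_mono)
  then have "2 * K \<le> 2 * (2 * n * k * (lmax + 1) + 3)" by (rule mult_le_mono2)
  also have "\<dots> = 4 * n * k * (lmax + 1) + 6" by simp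
  finally have K: "2 * K \<le> 4 * n * k * (lmax + 1) + 6" .
  have KX: "4 * real (2 * K) * N \<le> X"
    unfolding N_def X_def by (rule degree_times_dimension_bound[OF nmk K])
  have "K \<ge> 1" by (simp add: K_def)
  then have "1 * 1 \<le> 4 * real (2 * K) * N" using N1 by (intro mult_mono) auto
  then have KN: "1 \<le> 4 * real (2 * K) * N" by simp
  then have R0: "2 * N * log 2 X \<ge> 0"
    using N1 KX by (intro mult_nonneg_nonneg zero_le_log_cancel_iff[THEN iffD2]) auto
  have bound: "real (card D) \<le> 2 * N * log 2 X"
    if D: "finite D" "D \<subseteq> (input_space \<omega> :: (real \<Rightarrow> real ^ 'm) set) \<times> UNIV \<times> UNIV"
      and sh: "shatters (loss_concept L ` system_class TYPE('n)) D" for D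
  proof (cases "card D \<ge> 1")
    case True
    have "real (card D) \<le> 2 * N * log 2 (4 * real (2 * K) * N)"
    proof (rule le_log_of_exp_le_poly[OF True])
      show "2 ^ card D \<le> 2 * (card D * (2 * K) + 1) ^ CARD(('n, 'm) param)"
        by (rule shattered_set_bound[OF assms(4,6) D sh K_def])
      show "real CARD(('n, 'm) param) + 1 \<le> N"
        using param_count_bound[OF nmk(1,2)] unfolding card_param N_def assms(1,2) by simp
    qed (use \<open>K \<ge> 1\<close> in simp)
    also have "\<dots> \<le> 2 * N * log 2 X"
      using KX KN N1 by (intro mult_left_mono log_le_cancel_iff[THEN iffD2]) linarith+
    finally show ?thesis .
  next
    case False
    then show ?thesis using R0 by simp
  qed
  have "pseudo_dim (input_space \<omega> :: (real \<Rightarrow> real ^ 'm) set) UNIV (system_class TYPE('n)) L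
      \<le> enat (nat \<lfloor>2 * N * log 2 X\<rfloor>)"
    unfolding pseudo_dim_def VC_def
  proof (rule Sup_least)
    fix c assume "c \<in> {enat (card D) | D. D \<subseteq> (input_space \<omega> :: (real \<Rightarrow> real ^ 'm) set) \<times> UNIV \<times> UNIV \<and>
      finite D \<and> shatters (loss_concept L ` system_class TYPE('n)) D}"
    then obtain D where D: "c = enat (card D)" "D \<subseteq> (input_space \<omega> :: (real \<Rightarrow> real ^ 'm) set) \<times> UNIV \<times> UNIV"
      "finite D" "shatters (loss_concept L ` system_class TYPE('n)) D" by blast
    from bound[OF D(3,2,4)] show "c \<le> enat (nat \<lfloor>2 * N * log 2 X\<rfloor>)"
      by (simp add: D(1) le_nat_floor)
  qed
  then have "ereal_of_enat (pseudo_dim (input_space \<omega> :: (real \<Rightarrow> real ^ 'm) set) UNIV (system_class TYPE('n)) L)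
      \<le> ereal_of_enat (enat (nat \<lfloor>2 * N * log 2 X\<rfloor>))"
    by (simp only: ereal_of_enat_le_iff)
  also have "\<dots> \<le> ereal (2 * N * log 2 X)"
    using R0 by simp
  finally show ?thesis unfolding N_def X_def .
qed

end
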